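(* The calculus $\mathsf{Gb}$ is decidable: there is an algorithm which, given any sequent $\Gamma\Rightarrow\alpha$, decides whether $\vdash_{\mathsf{Gb}}\Gamma\Rightarrow\alpha$.
   Context: Formulas of $\mathsf{Gb}$: variables $p$, the constant $\bot$, and $\alpha\cdot\beta$, $\alpha\backslash\beta$, $\alpha\wedge\beta$, $\alpha\vee\beta$, $\alpha\ast\beta$, $\alpha\rightarrow\beta$. Formula structures: every formula is a structure, and if $\Gamma,\Delta$ are structures so are $(\Gamma,\Delta)$ and $(\Gamma;\Delta)$. A context $\Gamma[-]$ is a structure with one designated hole; $\Gamma[\Delta]$ is the result of filling it with $\Delta$. A sequent is $\Gamma\Rightarrow\alpha$ with $\Gamma$ a structure and $\alpha$ a formula. Rules of $\mathsf{Gb}$ (premises / conclusion): $(\mathrm{Id})$ $\alpha\Rightarrow\alpha$; $(\cdot\mathrm{L})$ $\Gamma[\alpha,\beta]\Rightarrow\gamma$ / $\Gamma[\alpha\cdot\beta]\Rightarrow\gamma$; $(\cdot\mathrm{R})$ $\Gamma_1\Rightarrow\alpha$, $\Gamma_2\Rightarrow\beta$ / $\Gamma_1,\Gamma_2\Rightarrow\alpha\cdot\beta$; $(\ast\mathrm{L})$ $\Gamma[\alpha;\beta]\Rightarrow\gamma$ / $\Gamma[\alpha\ast\beta]\Rightarrow\gamma$; $(\ast\mathrm{R})$ $\Gamma_1\Rightarrow\alpha$, $\Gamma_2\Rightarrow\beta$ / $\Gamma_1;\Gamma_2\Rightarrow\alpha\ast\beta$; $(\backslash\mathrm{L})$ $\Delta\Rightarrow\alpha$,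 $\Gamma[\beta]\Rightarrow\gamma$ / $\Gamma[\Delta,\alpha\backslash\beta]\Rightarrow\gamma$; $(\backslash\mathrm{R})$ $\alpha,\Gamma\Rightarrow\beta$ / $\Gamma\Rightarrow\alpha\backslash\beta$; $(\rightarrow\mathrm{L})$ $\Delta\Rightarrow\alpha$, $\Gamma[\beta]\Rightarrow\gamma$ / $\Gamma[\Delta;\alpha\rightarrow\beta]\Rightarrow\gamma$; $(\rightarrow\mathrm{R})$ $\alpha;\Gamma\Rightarrow\beta$ / $\Gamma\Rightarrow\alpha\rightarrow\beta$; $(\wedge\mathrm{L})$ $\Gamma[\alpha]\Rightarrow\beta$ / $\Gamma[\alpha\wedge\gamma]\Rightarrow\beta$ and $\Gamma[\alpha]\Rightarrow\beta$ / $\Gamma[\gamma\wedge\alpha]\Rightarrow\beta$; $(\wedge\mathrm{R})$ $\Gamma\Rightarrow\alpha$, $\Gamma\Rightarrow\beta$ / $\Gamma\Rightarrow\alpha\wedge\beta$; $(\vee\mathrm{L})$ $\Gamma[\alpha]\Rightarrow\gamma$, $\Gamma[\beta]\Rightarrow\gamma$ / $\Gamma[\alpha\vee\beta]\Rightarrow\gamma$; $(\vee\mathrm{R})$ $\Gamma\Rightarrow\alpha$ / $\Gamma\Rightarrow\alpha\vee\beta$ and $\Gamma\Rightarrow\alpha$ / $\Gamma\Rightarrow\beta\vee\alpha$; $(\bot)$ $\Delta\Rightarrow\bot$ / $\Gamma[\Delta]\Rightarrow\alpha$; $(\mathrm{Cut})$ $\Delta\Rightarrow\alpha$, $\Gamma[\alpha]\Rightarrow\beta$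 / $\Gamma[\Delta]\Rightarrow\beta$; $(\mathrm{R}\text{-}\bot)$ $(\Delta_1,\Delta_2);\Delta_3\Rightarrow\bot$ / $(\Delta_1,\Delta_3);\Delta_2\Rightarrow\bot$; $(\mathrm{Ex})$ $\Gamma[\Delta_1,\Delta_2]\Rightarrow\beta$ / $\Gamma[\Delta_2,\Delta_1]\Rightarrow\beta$; $(\mathrm{Ex}^;)$ $\Gamma[\Delta_1;\Delta_2]\Rightarrow\beta$ / $\Gamma[\Delta_2;\Delta_1]\Rightarrow\beta$; $(\mathrm{As}_1)$ $\Gamma[\Delta_1,(\Delta_2,\Delta_3)]\Rightarrow\beta$ / $\Gamma[(\Delta_1,\Delta_2),\Delta_3]\Rightarrow\beta$; $(\mathrm{As}_2)$ the converse of $(\mathrm{As}_1)$. *)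

theory Defs
  imports Main "HOL-Library.Nat_Bijection"
begin

section \<open>The calculus Gb\<close>

datatype form =
    Var nat
  | Bot  (\<open>\<^bold>\<bottom>\<close>)
  | Fus form form  (infixr \<open>\<^bold>\<cdot>\<close> 70)
  | Under form form  (infixr \<open>\<^bold>\<setminus>\<close> 65)
  | Conj form form  (infixr \<open>\<^bold>\<and>\<close> 68)
  | Disj form form  (infixr \<open>\<^bold>\<or>\<close> 67)
  | Star form form  (infixr \<open>\<^bold>*\<close> 70)
  | Arr form form  (infixr \<open>\<^bold>\<rightarrow>\<close> 65)

datatype struc =
    F form
  | Comma struc struc  (infixl \<open>\<^bold>,\<close> 60)
  | Semi struc struc  (infixl \<open>\<^bold>;\<close> 60)

datatype ctx =
    Hole
  | CommaL ctx struc
  | CommaR struc ctx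
  | SemiL ctx struc
  | SemiR struc ctx

primrec fill :: "ctx \<Rightarrow> struc \<Rightarrow> struc"  (\<open>_\<langle>_\<rangle>\<close> [100, 0] 100) where
  "Hole\<langle>\<Delta>\<rangle> = \<Delta>"
| "(CommaL C \<Sigma>)\<langle>\<Delta>\<rangle> = (C\<langle>\<Delta>\<rangle> \<^bold>, \<Sigma>)"
| "(CommaR \<Sigma> C)\<langle>\<Delta>\<rangle> = (\<Sigma> \<^bold>, C\<langle>\<Delta>\<rangle>)"
| "(SemiL C \<Sigma>)\<langle>\<Delta>\<rangle> = (C\<langle>\<Delta>\<rangle> \<^bold>; \<Sigma>)"
| "(SemiR \<Sigma> C)\<langle>\<Delta>\<rangle> = (\<Sigma> \<^bold>; C\<langle>\<Delta>\<rangle>)"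

datatype sequent = Sequent struc form  (infix \<open>\<^bold>\<Rightarrow>\<close> 55)

inductive Gb :: "sequent \<Rightarrow> bool"  (\<open>\<turnstile>\<^sub>G\<^sub>b _\<close> [55] 54) where
  Id: "\<turnstile>\<^sub>G\<^sub>b F \<alpha> \<^bold>\<Rightarrow> \<alpha>"
| FusL: "\<turnstile>\<^sub>G\<^sub>b \<Gamma>\<langle>F \<alpha> \<^bold>, F \<beta>\<rangle> \<^bold>\<Rightarrow> \<gamma> \<Longrightarrow> \<turnstile>\<^sub>G\<^sub>b \<Gamma>\<langle>F (\<alpha> \<^bold>\<cdot> \<beta>)\<rangle> \<^bold>\<Rightarrow> \<gamma>"
| FusR: "\<turnstile>\<^sub>G\<^sub>b \<Gamma>\<^sub>1 \<^bold>\<Rightarrow> \<alpha> \<Longrightarrow> \<turnstile>\<^sub>G\<^sub>b \<Gamma>\<^sub>2 \<^bold>\<Rightarrow> \<beta> \<Longrightarrow> \<turnstile>\<^sub>G\<^sub>b \<Gamma>\<^sub>1 \<^bold>, \<Gamma>\<^sub>2 \<^bold>\<Rightarrow> \<alpha> \<^bold>\<cdot> \<beta>"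
| StarL: "\<turnstile>\<^sub>G\<^sub>b \<Gamma>\<langle>F \<alpha> \<^bold>; F \<beta>\<rangle> \<^bold>\<Rightarrow> \<gamma> \<Longrightarrow> \<turnstile>\<^sub>G\<^sub>b \<Gamma>\<langle>F (\<alpha> \<^bold>* \<beta>)\<rangle> \<^bold>\<Rightarrow> \<gamma>"
| StarR: "\<turnstile>\<^sub>G\<^sub>b \<Gamma>\<^sub>1 \<^bold>\<Rightarrow> \<alpha> \<Longrightarrow> \<turnstile>\<^sub>G\<^sub>b \<Gamma>\<^sub>2 \<^bold>\<Rightarrow> \<beta> \<Longrightarrow> \<turnstile>\<^sub>G\<^sub>b \<Gamma>\<^sub>1 \<^bold>; \<Gamma>\<^sub>2 \<^bold>\<Rightarrow> \<alpha> \<^bold>* \<beta>"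
| UnderL: "\<turnstile>\<^sub>G\<^sub>b \<Delta> \<^bold>\<Rightarrow> \<alpha> \<Longrightarrow> \<turnstile>\<^sub>G\<^sub>b \<Gamma>\<langle>F \<beta>\<rangle> \<^bold>\<Rightarrow> \<gamma> \<Longrightarrow> \<turnstile>\<^sub>G\<^sub>b \<Gamma>\<langle>\<Delta> \<^bold>, F (\<alpha> \<^bold>\<setminus> \<beta>)\<rangle> \<^bold>\<Rightarrow> \<gamma>"
| UnderR: "\<turnstile>\<^sub>G\<^sub>b F \<alpha> \<^bold>, \<Gamma> \<^bold>\<Rightarrow> \<beta> \<Longrightarrow> \<turnstile>\<^sub>G\<^sub>b \<Gamma> \<^bold>\<Rightarrow> \<alpha> \<^bold>\<setminus> \<beta>"
| ArrL: "\<turnstile>\<^sub>G\<^sub>b \<Delta> \<^bold>\<Rightarrow> \<alpha> \<Longrightarrow> \<turnstile>\<^sub>G\<^sub>b \<Gamma>\<langle>F \<beta>\<rangle> \<^bold>\<Rightarrow> \<gamma> \<Longrightarrow> \<turnstile>\<^sub>G\<^sub>b \<Gamma>\<langle>\<Delta> \<^bold>; F (\<alpha> \<^bold>\<rightarrow> \<beta>)\<rangle> \<^bold>\<Rightarrow> \<gamma>"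
| ArrR: "\<turnstile>\<^sub>G\<^sub>b F \<alpha> \<^bold>; \<Gamma> \<^bold>\<Rightarrow> \<beta> \<Longrightarrow> \<turnstile>\<^sub>G\<^sub>b \<Gamma> \<^bold>\<Rightarrow> \<alpha> \<^bold>\<rightarrow> \<beta>"
| ConjL1: "\<turnstile>\<^sub>G\<^sub>b \<Gamma>\<langle>F \<alpha>\<rangle> \<^bold>\<Rightarrow> \<beta> \<Longrightarrow> \<turnstile>\<^sub>G\<^sub>b \<Gamma>\<langle>F (\<alpha> \<^bold>\<and> \<gamma>)\<rangle> \<^bold>\<Rightarrow> \<beta>"
| ConjL2: "\<turnstile>\<^sub>G\<^sub>b \<Gamma>\<langle>F \<alpha>\<rangle> \<^bold>\<Rightarrow> \<beta> \<Longrightarrow> \<turnstile>\<^sub>G\<^sub>b \<Gamma>\<langle>F (\<gamma> \<^bold>\<and> \<alpha>)\<rangle> \<^bold>\<Rightarrow> \<beta>"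
| ConjR: "\<turnstile>\<^sub>G\<^sub>b \<Gamma> \<^bold>\<Rightarrow> \<alpha> \<Longrightarrow> \<turnstile>\<^sub>G\<^sub>b \<Gamma> \<^bold>\<Rightarrow> \<beta> \<Longrightarrow> \<turnstile>\<^sub>G\<^sub>b \<Gamma> \<^bold>\<Rightarrow> \<alpha> \<^bold>\<and> \<beta>"
| DisjL: "\<turnstile>\<^sub>G\<^sub>b \<Gamma>\<langle>F \<alpha>\<rangle> \<^bold>\<Rightarrow> \<gamma> \<Longrightarrow> \<turnstile>\<^sub>G\<^sub>b \<Gamma>\<langle>F \<beta>\<rangle> \<^bold>\<Rightarrow> \<gamma> \<Longrightarrow> \<turnstile>\<^sub>G\<^sub>b \<Gamma>\<langle>F (\<alpha> \<^bold>\<or> \<beta>)\<rangle> \<^bold>\<Rightarrow> \<gamma>"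
| DisjR1: "\<turnstile>\<^sub>G\<^sub>b \<Gamma> \<^bold>\<Rightarrow> \<alpha> \<Longrightarrow> \<turnstile>\<^sub>G\<^sub>b \<Gamma> \<^bold>\<Rightarrow> \<alpha> \<^bold>\<or> \<beta>"
| DisjR2: "\<turnstile>\<^sub>G\<^sub>b \<Gamma> \<^bold>\<Rightarrow> \<alpha> \<Longrightarrow> \<turnstile>\<^sub>G\<^sub>b \<Gamma> \<^bold>\<Rightarrow> \<beta> \<^bold>\<or> \<alpha>"
| BotRule: "\<turnstile>\<^sub>G\<^sub>b \<Delta> \<^bold>\<Rightarrow> \<^bold>\<bottom> \<Longrightarrow> \<turnstile>\<^sub>G\<^sub>b \<Gamma>\<langle>\<Delta>\<rangle> \<^bold>\<Rightarrow> \<alpha>"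
| Cut: "\<turnstile>\<^sub>G\<^sub>b \<Delta> \<^bold>\<Rightarrow> \<alpha> \<Longrightarrow> \<turnstile>\<^sub>G\<^sub>b \<Gamma>\<langle>F \<alpha>\<rangle> \<^bold>\<Rightarrow> \<beta> \<Longrightarrow> \<turnstile>\<^sub>G\<^sub>b \<Gamma>\<langle>\<Delta>\<rangle> \<^bold>\<Rightarrow> \<beta>"
| RBot: "\<turnstile>\<^sub>G\<^sub>b (\<Delta>\<^sub>1 \<^bold>, \<Delta>\<^sub>2) \<^bold>; \<Delta>\<^sub>3 \<^bold>\<Rightarrow> \<^bold>\<bottom> \<Longrightarrow> \<turnstile>\<^sub>G\<^sub>b (\<Delta>\<^sub>1 \<^bold>, \<Delta>\<^sub>3) \<^bold>; \<Delta>\<^sub>2 \<^bold>\<Rightarrow> \<^bold>\<bottom>"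
| Ex: "\<turnstile>\<^sub>G\<^sub>b \<Gamma>\<langle>\<Delta>\<^sub>1 \<^bold>, \<Delta>\<^sub>2\<rangle> \<^bold>\<Rightarrow> \<beta> \<Longrightarrow> \<turnstile>\<^sub>G\<^sub>b \<Gamma>\<langle>\<Delta>\<^sub>2 \<^bold>, \<Delta>\<^sub>1\<rangle> \<^bold>\<Rightarrow> \<beta>"
| ExSemi: "\<turnstile>\<^sub>G\<^sub>b \<Gamma>\<langle>\<Delta>\<^sub>1 \<^bold>; \<Delta>\<^sub>2\<rangle> \<^bold>\<Rightarrow> \<beta> \<Longrightarrow> \<turnstile>\<^sub>G\<^sub>b \<Gamma>\<langle>\<Delta>\<^sub>2 \<^bold>; \<Delta>\<^sub>1\<rangle> \<^bold>\<Rightarrow> \<beta>"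
| As1: "\<turnstile>\<^sub>G\<^sub>b \<Gamma>\<langle>\<Delta>\<^sub>1 \<^bold>, (\<Delta>\<^sub>2 \<^bold>, \<Delta>\<^sub>3)\<rangle> \<^bold>\<Rightarrow> \<beta> \<Longrightarrow> \<turnstile>\<^sub>G\<^sub>b \<Gamma>\<langle>(\<Delta>\<^sub>1 \<^bold>, \<Delta>\<^sub>2) \<^bold>, \<Delta>\<^sub>3\<rangle> \<^bold>\<Rightarrow> \<beta>"
| As2: "\<turnstile>\<^sub>G\<^sub>b \<Gamma>\<langle>(\<Delta>\<^sub>1 \<^bold>, \<Delta>\<^sub>2) \<^bold>, \<Delta>\<^sub>3\<rangle> \<^bold>\<Rightarrow> \<beta> \<Longrightarrow> \<turnstile>\<^sub>G\<^sub>b \<Gamma>\<langle>\<Delta>\<^sub>1 \<^bold>, (\<Delta>\<^sub>2 \<^bold>, \<Delta>\<^sub>3)\<rangle> \<^bold>\<Rightarrow> \<beta>"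

section \<open>Algorithms: partial recursive functions\<close>

datatype recf =
    Zero
  | Succ
  | Proj nat
  | Comp recf "recf list"
  | PrimRec recf recf
  | Mu recf

text \<open>
  \<open>computes f xs y\<close>: the program \<open>f\<close> halts on the arguments \<open>xs\<close> with result \<open>y\<close>.
  Programs carry no arity; \<open>Zero\<close> and \<open>Proj i\<close> stand for the
  zero function and the projection to argument \<open>i\<close> (counted from 0) of every suitable arity.
  In \<open>PrimRec f g\<close>, the recursion is on the first argument, and the step function \<open>g\<close>
  receives the counter, the previous value and the parameters, in this order.
\<close>

inductive computes :: "recf \<Rightarrow> nat list \<Rightarrow> nat \<Rightarrow> bool" where
  zero: "computes Zero xs 0"
| succ: "computes Succ [x] (Suc x)"
| proj: "i < length xs \<Longrightarrow> computes (Proj i) xs (xs ! i)"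
| comp: "list_all2 (\<lambda>g y. computes g xs y) gs ys \<Longrightarrow> computes f ys z \<Longrightarrow>
    computes (Comp f gs) xs z"
| primrec_0: "computes f xs y \<Longrightarrow> computes (PrimRec f g) (0 # xs) y"
| primrec_Suc: "computes (PrimRec f g) (n # xs) y \<Longrightarrow> computes g (n # y # xs) z \<Longrightarrow>
    computes (PrimRec f g) (Suc n # xs) z"
| mu: "computes f (n # xs) 0 \<Longrightarrow> (\<forall>m<n. \<exists>y. computes f (m # xs) (Suc y)) \<Longrightarrow>
    computes (Mu f) xs n"

lemma computes_deterministic: "computes f xs y \<Longrightarrow> computes f xs z \<Longrightarrow> y = z"
proof (induction arbitrary: z rule: computes.induct)
  case (comp xs gs ys f w)
  from comp.prems obtain ys' where ys': "list_all2 (\<lambda>g y. computes g xs y) gs ys'" "computes f ys' z"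
    by (cases rule: computes.cases) auto
  have "ys = ys'"
    using comp.IH(1) ys'(1) by (auto simp: list_all2_conv_all_nth intro: nth_equalityI)
  then show ?case using comp.IH ys'(2) by blast
next
  case (primrec_Suc f g n xs y w)
  from primrec_Suc.prems obtain y' where "computes (PrimRec f g) (n # xs) y'" "computes g (n # y' # xs) z"
    by (cases rule: computes.cases) auto
  then show ?case using primrec_Suc.IH by blast
next
  case (mu f n xs)
  from mu.prems have z: "computes f (z # xs) 0" "\<forall>m<z. \<exists>y. computes f (m # xs) (Suc y)"
    by (cases rule: computes.cases; auto)+
  show ?case
  proof (rule linorder_cases[of n z])
    assume "n < z"
    then show ?thesis using z(2) mu.IH(1) by (metis nat.distinct(1))
  next
    assume "z < n"
    then show ?thesis using z(1) mu.IH(2) by (metis nat.distinct(1))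
  qed simp
qed (erule computes.cases; auto)+

text \<open>
  Only meaningful for an effective injective numbering \<open>code\<close> of the instances; one
  program must halt with the correct answer on every instance.
\<close>

definition decidable_wrt :: "('a \<Rightarrow> nat) \<Rightarrow> ('a \<Rightarrow> bool) \<Rightarrow> bool" where
  "decidable_wrt code P \<longleftrightarrow>
    (\<exists>f. \<forall>x. computes f [code x] (if P x then 1 else 0))"

section \<open>Goedel numbering of sequents\<close>

primrec form_code :: "form \<Rightarrow> nat" where
  "form_code (Var n) = prod_encode (0, n)"
| "form_code \<^bold>\<bottom> = prod_encode (1, 0)"
| "form_code (\<alpha> \<^bold>\<cdot> \<beta>) = prod_encode (2, prod_encode (form_code \<alpha>, form_code \<beta>))"
| "form_code (\<alpha> \<^bold>\<setminus> \<beta>) = prod_encode (3, prod_encode (form_code \<alpha>, form_code \<beta>))"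
| "form_code (\<alpha> \<^bold>\<and> \<beta>) = prod_encode (4, prod_encode (form_code \<alpha>, form_code \<beta>))"
| "form_code (\<alpha> \<^bold>\<or> \<beta>) = prod_encode (5, prod_encode (form_code \<alpha>, form_code \<beta>))"
| "form_code (\<alpha> \<^bold>* \<beta>) = prod_encode (6, prod_encode (form_code \<alpha>, form_code \<beta>))"
| "form_code (\<alpha> \<^bold>\<rightarrow> \<beta>) = prod_encode (7, prod_encode (form_code \<alpha>, form_code \<beta>))"

primrec struc_code :: "struc \<Rightarrow> nat" where
  "struc_code (F \<alpha>) = prod_encode (0, form_code \<alpha>)"
| "struc_code (\<Gamma> \<^bold>, \<Delta>) = prod_encode (1, prod_encode (struc_code \<Gamma>, struc_code \<Delta>))"
| "struc_code (\<Gamma> \<^bold>; \<Delta>) = prod_encode (2, prod_encode (struc_code \<Gamma>, struc_code \<Delta>))"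

primrec sequent_code :: "sequent \<Rightarrow> nat" where
  "sequent_code (\<Gamma> \<^bold>\<Rightarrow> \<alpha>) = prod_encode (struc_code \<Gamma>, form_code \<alpha>)"

lemma form_code_inj: "form_code \<alpha> = form_code \<beta> \<Longrightarrow> \<alpha> = \<beta>"
  by (induction \<alpha> arbitrary: \<beta>; case_tac \<beta>) (auto simp: prod_encode_eq)

lemma struc_code_inj: "struc_code \<Gamma> = struc_code \<Delta> \<Longrightarrow> \<Gamma> = \<Delta>"
  by (induction \<Gamma> arbitrary: \<Delta>; case_tac \<Delta>) (auto simp: prod_encode_eq dest: form_code_inj)

lemma inj_sequent_code: "inj sequent_code"
proof (rule injI)
  show "s = t" if "sequent_code s = sequent_code t" for s t
    using that by (cases s; cases t) (auto simp: prod_encode_eq dest: form_code_inj struc_code_inj)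
qed

end

theory Submission
  imports Defs
begin

text \<open>
  Cut elimination is proved semantically. The structures together with the pairs of a context \<open>C\<close>
  and a formula \<open>c\<close>, related by cut-free provability of \<open>C[x] \<Rightarrow> c\<close>, form a residuated frame; its
  Galois-closed sets validate all rules of Gb, including Cut, and by Okada's lemma the value of
  every formula \<open>\<alpha>\<close> contains \<open>\<alpha>\<close> and consists of cut-free antecedents of \<open>\<alpha>\<close>. The rule
  \<open>(R-\<bottom>)\<close> is valid because the rule \<open>(\<bottom>)\<close> makes the antecedents of \<open>\<bottom>\<close> the least closed set.

  Without Cut no premise is heavier than its conclusion, so only sequents below a computable bound
  \<open>B\<close> can occur in a derivation of a given sequent. The rules are finitely many Horn clauses over
  codes, with an auxiliary judgement \<open>lstep\<close> that pushes left rules into contexts; a sequent is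
  derivable iff its code lies in every subset of \<open>{..B}\<close> that is closed under these clauses, and
  this involves bounded quantifiers only.
\<close>

section \<open>A local cut-free calculus\<close>

inductive cf :: "struc \<Rightarrow> form \<Rightarrow> bool" and lstep :: "struc \<Rightarrow> struc \<Rightarrow> struc \<Rightarrow> bool" where
  cf_Id: "cf (F a) a"
| cf_left: "lstep X Y Z \<Longrightarrow> cf X c \<Longrightarrow> cf Y c \<Longrightarrow> cf Z c"
| cf_FusR: "cf X a \<Longrightarrow> cf Y b \<Longrightarrow> cf (X \<^bold>, Y) (a \<^bold>\<cdot> b)"
| cf_StarR: "cf X a \<Longrightarrow> cf Y b \<Longrightarrow> cf (X \<^bold>; Y) (a \<^bold>* b)"
| cf_UnderR: "cf (F a \<^bold>, X) b \<Longrightarrow> cf X (a \<^bold>\<setminus> b)"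
| cf_ArrR: "cf (F a \<^bold>; X) b \<Longrightarrow> cf X (a \<^bold>\<rightarrow> b)"
| cf_ConjR: "cf X a \<Longrightarrow> cf X b \<Longrightarrow> cf X (a \<^bold>\<and> b)"
| cf_DisjR1: "cf X a \<Longrightarrow> cf X (a \<^bold>\<or> b)"
| cf_DisjR2: "cf X b \<Longrightarrow> cf X (a \<^bold>\<or> b)"
| cf_Bot: "cf X \<^bold>\<bottom> \<Longrightarrow> cf X a"
| cf_BotCommaL: "cf X \<^bold>\<bottom> \<Longrightarrow> cf (X \<^bold>, W) \<^bold>\<bottom>"
| cf_BotCommaR: "cf X \<^bold>\<bottom> \<Longrightarrow> cf (W \<^bold>, X) \<^bold>\<bottom>"
| cf_BotSemiL: "cf X \<^bold>\<bottom> \<Longrightarrow> cf (X \<^bold>; W) \<^bold>\<bottom>"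
| cf_BotSemiR: "cf X \<^bold>\<bottom> \<Longrightarrow> cf (W \<^bold>; X) \<^bold>\<bottom>"
| cf_RBot: "cf ((X \<^bold>, Y) \<^bold>; Z) \<^bold>\<bottom> \<Longrightarrow> cf ((X \<^bold>, Z) \<^bold>; Y) \<^bold>\<bottom>"
| ls_Fus: "lstep (F a \<^bold>, F b) (F a \<^bold>, F b) (F (a \<^bold>\<cdot> b))"
| ls_Star: "lstep (F a \<^bold>; F b) (F a \<^bold>; F b) (F (a \<^bold>* b))"
| ls_Under: "cf X a \<Longrightarrow> lstep (F b) (F b) (X \<^bold>, F (a \<^bold>\<setminus> b))"
| ls_Arr: "cf X a \<Longrightarrow> lstep (F b) (F b) (X \<^bold>; F (a \<^bold>\<rightarrow> b))"
| ls_Conj1: "lstep (F a) (F a) (F (a \<^bold>\<and> b))"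
| ls_Conj2: "lstep (F b) (F b) (F (a \<^bold>\<and> b))"
| ls_Disj: "lstep (F a) (F b) (F (a \<^bold>\<or> b))"
| ls_Ex: "lstep (X \<^bold>, Y) (X \<^bold>, Y) (Y \<^bold>, X)"
| ls_ExSemi: "lstep (X \<^bold>; Y) (X \<^bold>; Y) (Y \<^bold>; X)"
| ls_As1: "lstep (X \<^bold>, (Y \<^bold>, Z)) (X \<^bold>, (Y \<^bold>, Z)) ((X \<^bold>, Y) \<^bold>, Z)"
| ls_As2: "lstep ((X \<^bold>, Y) \<^bold>, Z) ((X \<^bold>, Y) \<^bold>, Z) (X \<^bold>, (Y \<^bold>, Z))"
| ls_CommaL: "lstep X Y Z \<Longrightarrow> lstep (X \<^bold>, W) (Y \<^bold>, W) (Z \<^bold>, W)"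
| ls_CommaR: "lstep X Y Z \<Longrightarrow> lstep (W \<^bold>, X) (W \<^bold>, Y) (W \<^bold>, Z)"
| ls_SemiL: "lstep X Y Z \<Longrightarrow> lstep (X \<^bold>; W) (Y \<^bold>; W) (Z \<^bold>; W)"
| ls_SemiR: "lstep X Y Z \<Longrightarrow> lstep (W \<^bold>; X) (W \<^bold>; Y) (W \<^bold>; Z)"

lemma lstep_fill: "lstep X Y Z \<Longrightarrow> lstep (C\<langle>X\<rangle>) (C\<langle>Y\<rangle>) (C\<langle>Z\<rangle>)"
  by (induction C) (auto intro: ls_CommaL ls_CommaR ls_SemiL ls_SemiR)

lemma cf_left_fill: "lstep X Y Z \<Longrightarrow> cf (C\<langle>X\<rangle>) c \<Longrightarrow> cf (C\<langle>Y\<rangle>) c \<Longrightarrow> cf (C\<langle>Z\<rangle>) c"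
  by (blast intro: cf_left lstep_fill)

lemma cf_Bot_fill: "cf X \<^bold>\<bottom> \<Longrightarrow> cf (C\<langle>X\<rangle>) a"
  by (rule cf_Bot, induction C) (auto intro: cf_BotCommaL cf_BotCommaR cf_BotSemiL cf_BotSemiR)

primrec ctx_comp :: "ctx \<Rightarrow> ctx \<Rightarrow> ctx" where
  "ctx_comp Hole D = D"
| "ctx_comp (CommaL C X) D = CommaL (ctx_comp C D) X"
| "ctx_comp (CommaR X C) D = CommaR X (ctx_comp C D)"
| "ctx_comp (SemiL C X) D = SemiL (ctx_comp C D) X"
| "ctx_comp (SemiR X C) D = SemiR X (ctx_comp C D)"

lemma fill_ctx_comp [simp]: "(ctx_comp C D)\<langle>X\<rangle> = C\<langle>D\<langle>X\<rangle>\<rangle>"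
  by (induction C) auto

section \<open>Cut elimination\<close>

text \<open>The basic closed sets are \<open>{x. cf (C<x>) c}\<close>, one for each context and
  formula; \<open>cl A\<close> is the intersection of those that include \<open>A\<close>.\<close>

definition cl :: "struc set \<Rightarrow> struc set" where
  "cl A = {s. \<forall>C c. (\<forall>x\<in>A. cf (C\<langle>x\<rangle>) c) \<longrightarrow> cf (C\<langle>s\<rangle>) c}"

lemma cl_increasing: "x \<in> A \<Longrightarrow> x \<in> cl A"
  by (auto simp: cl_def)

lemma cl_idem: "cl (cl A) \<subseteq> cl A"
  by (auto simp: cl_def)

lemma cl_cf: "s \<in> cl A \<Longrightarrow> (\<And>x. x \<in> A \<Longrightarrow> cf x c) \<Longrightarrow> cf s c"
  unfolding cl_def by (drule CollectD, drule spec[of _ Hole]) simp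

text \<open>Contexts compose, so the preimage of a basic closed set under filling \<open>C\<close>
  is again basic. Hence preimages of closed sets are closed, which is what makes the residuals well
  behaved.\<close>

lemma closed_fill:
  assumes "cl G \<subseteq> G" "s \<in> cl A" "\<And>x. x \<in> A \<Longrightarrow> C\<langle>x\<rangle> \<in> G"
  shows "C\<langle>s\<rangle> \<in> G"
proof -
  have "cf (D\<langle>C\<langle>s\<rangle>\<rangle>) c" if "\<forall>g\<in>G. cf (D\<langle>g\<rangle>) c" for D c
  proof -
    have "\<forall>x\<in>A. cf ((ctx_comp D C)\<langle>x\<rangle>) c" using that assms(3) by simp
    then have "cf ((ctx_comp D C)\<langle>s\<rangle>) c" using assms(2) unfolding cl_def by blast
    then show ?thesis by simp
  qed
  then show ?thesis using assms(1) by (auto simp: cl_def)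
qed

lemma closed_lstep:
  assumes "cl G \<subseteq> G" "lstep X Y Z" "C\<langle>X\<rangle> \<in> G" "C\<langle>Y\<rangle> \<in> G"
  shows "C\<langle>Z\<rangle> \<in> G"
proof (rule closed_fill[OF assms(1)])
  show "Z \<in> cl {X, Y}" using assms(2) by (auto simp: cl_def intro: cf_left_fill)
qed (use assms in auto)

section \<open>Interpretation of formulas by closed sets\<close>

primrec sem :: "form \<Rightarrow> struc set" where
  "sem (Var n) = {s. cf s (Var n)}"
| "sem \<^bold>\<bottom> = {s. cf s \<^bold>\<bottom>}"
| "sem (a \<^bold>\<cdot> b) = cl {x \<^bold>, y |x y. x \<in> sem a \<and> y \<in> sem b}"
| "sem (a \<^bold>\<setminus> b) = {s. \<forall>x\<in>sem a. (x \<^bold>, s) \<in> sem b}"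
| "sem (a \<^bold>\<and> b) = sem a \<inter> sem b"
| "sem (a \<^bold>\<or> b) = cl (sem a \<union> sem b)"
| "sem (a \<^bold>* b) = cl {x \<^bold>; y |x y. x \<in> sem a \<and> y \<in> sem b}"
| "sem (a \<^bold>\<rightarrow> b) = {s. \<forall>x\<in>sem a. (x \<^bold>; s) \<in> sem b}"

text \<open>Variables and \<open>Bot\<close> denote basic closed sets, products and joins are
  closures, and a residual is an intersection of preimages of a closed set under contexts.\<close>

lemma sem_closed: "cl (sem a) \<subseteq> sem a"
proof (induction a)
  case (Under a b)
  show ?case
  proof
    fix s assume s: "s \<in> cl (sem (a \<^bold>\<setminus> b))"
    have "(CommaR x Hole)\<langle>s\<rangle> \<in> sem b" if "x \<in> sem a" for x
      using Under(2) s by (rule closed_fill) (use that in auto)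
    then show "s \<in> sem (a \<^bold>\<setminus> b)" by simp
  qed
next
  case (Arr a b)
  show ?case
  proof
    fix s assume s: "s \<in> cl (sem (a \<^bold>\<rightarrow> b))"
    have "(SemiR x Hole)\<langle>s\<rangle> \<in> sem b" if "x \<in> sem a" for x
      using Arr(2) s by (rule closed_fill) (use that in auto)
    then show "s \<in> sem (a \<^bold>\<rightarrow> b)" by simp
  qed
next
  case (Conj a b)
  have "cl (sem a \<inter> sem b) \<subseteq> cl (sem a)" "cl (sem a \<inter> sem b) \<subseteq> cl (sem b)"
    by (auto simp: cl_def)
  then show ?case using Conj by auto
qed (auto intro: cl_cf dest!: subsetD[OF cl_idem])

lemma sem_lstep: "lstep X Y Z \<Longrightarrow> C\<langle>X\<rangle> \<in> sem a \<Longrightarrow> C\<langle>Y\<rangle> \<in> sem a \<Longrightarrow> C\<langle>Z\<rangle> \<in> sem a"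
  using closed_lstep[OF sem_closed] .

lemma sem_lstep_Hole: "lstep X X Z \<Longrightarrow> X \<in> sem a \<Longrightarrow> Z \<in> sem a"
  using sem_lstep[of X X Z Hole] by simp

text \<open>Such an \<open>s\<close> may stand in any context before any succedent, so it lies in
  every basic closed set.\<close>

lemma cf_Bot_sem: "cf s \<^bold>\<bottom> \<Longrightarrow> s \<in> sem a"
  using sem_closed[of a] cf_Bot_fill by (auto simp: cl_def)

text \<open>Both halves need one induction: for an implication, the left rule uses that members of
  \<open>sem a\<close> derive \<open>a\<close>, while the right rule feeds \<open>F a\<close>
  itself, as a member of \<open>sem a\<close>, to the implication.\<close>

lemma okada: "F a \<in> sem a \<and> (\<forall>s\<in>sem a. cf s a)"
proof (induction a)
  case (Fus a b)
  then have "F (a \<^bold>\<cdot> b) \<in> sem (a \<^bold>\<cdot> b)"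
    by (intro sem_lstep_Hole[OF ls_Fus]) (auto intro!: cl_increasing)
  moreover have "cf s (a \<^bold>\<cdot> b)" if "s \<in> sem (a \<^bold>\<cdot> b)" for s
    using that unfolding sem.simps by (rule cl_cf) (use Fus in \<open>auto intro: cf_FusR\<close>)
  ultimately show ?case by blast
next
  case (Star a b)
  then have "F (a \<^bold>* b) \<in> sem (a \<^bold>* b)"
    by (intro sem_lstep_Hole[OF ls_Star]) (auto intro!: cl_increasing)
  moreover have "cf s (a \<^bold>* b)" if "s \<in> sem (a \<^bold>* b)" for s
    using that unfolding sem.simps by (rule cl_cf) (use Star in \<open>auto intro: cf_StarR\<close>)
  ultimately show ?case by blast
next
  case (Disj a b)
  have "F (a \<^bold>\<or> b) \<in> sem (a \<^bold>\<or> b)"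
    using sem_lstep[OF ls_Disj, of Hole a "a \<^bold>\<or> b" b] Disj by (auto intro: cl_increasing)
  moreover have "cf s (a \<^bold>\<or> b)" if "s \<in> sem (a \<^bold>\<or> b)" for s
    using that unfolding sem.simps
    by (rule cl_cf) (use Disj in \<open>auto intro: cf_DisjR1 cf_DisjR2\<close>)
  ultimately show ?case by blast
next
  case (Conj a b)
  then show ?case
    by (auto intro: cf_ConjR sem_lstep_Hole[OF ls_Conj1] sem_lstep_Hole[OF ls_Conj2])
next
  case (Under a b)
  then show ?case
    by (auto intro: cf_UnderR sem_lstep_Hole[OF ls_Under])
next
  case (Arr a b)
  then show ?case
    by (auto intro: cf_ArrR sem_lstep_Hole[OF ls_Arr])
qed (auto intro: cf_Id)

section \<open>Interpretation of structures and soundness of Gb\<close>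

primrec ssem :: "struc \<Rightarrow> struc set" where
  "ssem (F a) = sem a"
| "ssem (X \<^bold>, Y) = {x \<^bold>, y |x y. x \<in> ssem X \<and> y \<in> ssem Y}"
| "ssem (X \<^bold>; Y) = {x \<^bold>; y |x y. x \<in> ssem X \<and> y \<in> ssem Y}"

text \<open>A context denotes the set of contexts obtained by replacing each side structure by a
  member of its value. No closure is taken, so \<open>ssem\<close> of a filled context splits
  exactly into a context part and a hole part.\<close>

primrec csem :: "ctx \<Rightarrow> ctx set" where
  "csem Hole = {Hole}"
| "csem (CommaL C X) = (\<Union>x\<in>ssem X. (\<lambda>D. CommaL D x) ` csem C)"
| "csem (CommaR X C) = (\<Union>x\<in>ssem X. CommaR x ` csem C)"
| "csem (SemiL C X) = (\<Union>x\<in>ssem X. (\<lambda>D. SemiL D x) ` csem C)"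
| "csem (SemiR X C) = (\<Union>x\<in>ssem X. SemiR x ` csem C)"

lemma ssem_fill: "s \<in> ssem (C\<langle>X\<rangle>) \<longleftrightarrow> (\<exists>D\<in>csem C. \<exists>x\<in>ssem X. s = D\<langle>x\<rangle>)"
  by (induction C arbitrary: s) (simp, (simp, blast)+)

lemma ssem_refl: "X \<in> ssem X"
  using okada by (induction X) auto

text \<open>This reduces every left rule to a statement about the hole inside an arbitrary semantic
  context, where \<open>closed_fill\<close> or \<open>sem_lstep\<close> applies.\<close>

lemma ssem_fill_subset:
  "ssem (C\<langle>X\<rangle>) \<subseteq> G \<longleftrightarrow> (\<forall>D\<in>csem C. \<forall>x\<in>ssem X. D\<langle>x\<rangle> \<in> G)"
  by (auto simp: ssem_fill subset_iff)

lemma Gb_sem_sound: "\<turnstile>\<^sub>G\<^sub>b s \<Longrightarrow> (case s of X \<^bold>\<Rightarrow> a \<Rightarrow> ssem X \<subseteq> sem a)"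
proof (induction rule: Gb.induct)
  case (FusL C a b c)
  then show ?case
    unfolding sequent.case ssem_fill_subset
    by (auto intro: closed_fill[OF sem_closed])
next
  case (FusR X a Y b)
  then show ?case by (auto intro!: cl_increasing)
next
  case (StarL C a b c)
  then show ?case
    unfolding sequent.case ssem_fill_subset
    by (auto intro: closed_fill[OF sem_closed])
next
  case (StarR X a Y b)
  then show ?case by (auto intro!: cl_increasing)
next
  case (UnderL X a C b c)
  then show ?case unfolding sequent.case ssem_fill_subset by auto
next
  case (UnderR a X b)
  then show ?case by auto
next
  case (ArrL X a C b c)
  then show ?case unfolding sequent.case ssem_fill_subset by auto
next
  case (ArrR a X b)
  then show ?case by auto
next
  case (DisjL C a c b)
  then show ?case
    unfolding sequent.case ssem_fill_subset
    by (auto intro: closed_fill[OF sem_closed])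
next
  case (BotRule X C a)
  then show ?case
    unfolding sequent.case ssem_fill_subset by (auto intro: cf_Bot_sem cf_Bot_fill)
next
  \<comment> \<open>Membership in \<open>sem Bot\<close> is cut-free derivability of
    \<open>Bot\<close>, so the calculus rule applies to each element directly.\<close>
  case (RBot X Y Z)
  then show ?case by (clarsimp simp: subset_iff) (rule cf_RBot, blast)
next
  case (Ex C X Y b)
  then show ?case
    unfolding sequent.case ssem_fill_subset by clarsimp (rule sem_lstep[OF ls_Ex]; blast)
next
  case (ExSemi C X Y b)
  then show ?case
    unfolding sequent.case ssem_fill_subset by clarsimp (rule sem_lstep[OF ls_ExSemi]; blast)
next
  case (As1 C X Y Z b)
  then show ?case
    unfolding sequent.case ssem_fill_subset by clarsimp (rule sem_lstep[OF ls_As1]; blast)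
next
  case (As2 C X Y Z b)
  then show ?case
    unfolding sequent.case ssem_fill_subset by clarsimp (rule sem_lstep[OF ls_As2]; blast)
\<comment> \<open>This covers Cut: the value of the cut formula includes the value of the structure
  replacing it, so the second premise restricts to it.\<close>
qed (auto simp: ssem_fill_subset intro: cl_increasing)

text \<open>By reflexivity and soundness \<open>X\<close> lies in \<open>sem a\<close>, whose
  members derive \<open>a\<close> without Cut.\<close>

lemma cut_elimination: "\<turnstile>\<^sub>G\<^sub>b X \<^bold>\<Rightarrow> a \<Longrightarrow> cf X a"
  using Gb_sem_sound[of "X \<^bold>\<Rightarrow> a"] ssem_refl[of X] okada[of a] by auto

section \<open>Recursive functions and predicates\<close>

definition recursive :: "nat \<Rightarrow> (nat list \<Rightarrow> nat) \<Rightarrow> bool" where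
  "recursive k f \<longleftrightarrow> (\<exists>r. \<forall>xs. length xs = k \<longrightarrow> computes r xs (f xs))"

lemma recursive_cong:
  "recursive k f \<Longrightarrow> (\<And>xs. length xs = k \<Longrightarrow> f xs = g xs) \<Longrightarrow> recursive k g"
  unfolding recursive_def by metis

lemma recursive_proj: "i < k \<Longrightarrow> recursive k (\<lambda>xs. xs ! i)"
  unfolding recursive_def by (metis computes.proj)

lemma recursive_comp:
  assumes "recursive (length fs) g" "\<forall>f\<in>set fs. recursive k f"
  shows "recursive k (\<lambda>xs. g (map (\<lambda>f. f xs) fs))"
proof -
  obtain r where r: "\<And>ys. length ys = length fs \<Longrightarrow> computes r ys (g ys)"
    using assms(1) unfolding recursive_def by blast
  obtain p where p: "\<And>f xs. f \<in> set fs \<Longrightarrow> length xs = k \<Longrightarrow> computes (p f) xs (f xs)"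
    using assms(2) unfolding recursive_def by metis
  have "computes (Comp r (map p fs)) xs (g (map (\<lambda>f. f xs) fs))" if "length xs = k" for xs
    by (rule computes.comp[OF _ r]) (auto simp: list_all2_conv_all_nth that p)
  then show ?thesis unfolding recursive_def by blast
qed

text \<open>\<open>PrimRec\<close> recurses on its first argument, whereas here the number of rounds
  is any recursive function of the parameters.\<close>

lemma recursive_prim:
  assumes "recursive k n" "recursive k z" "recursive (Suc (Suc k)) s"
  shows "recursive k (\<lambda>xs. rec_nat (z xs) (\<lambda>i r. s (i # r # xs)) (n xs))"
proof -
  obtain rz rs where rz: "\<And>xs. length xs = k \<Longrightarrow> computes rz xs (z xs)"
    and rs: "\<And>xs. length xs = Suc (Suc k) \<Longrightarrow> computes rs xs (s xs)"
    using assms(2,3) unfolding recursive_def by blast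
  have *: "computes (PrimRec rz rs) (m # xs) (rec_nat (z xs) (\<lambda>i r. s (i # r # xs)) m)"
    if "length xs = k" for m xs
    by (induction m) (use that in \<open>auto intro!: rz rs primrec_0 primrec_Suc\<close>)
  \<comment> \<open>\<open>?g\<close> is the bare recursion on the head of its argument list.
    Composing it with \<open>n\<close> and all \<open>k\<close> projections supplies the counter and
    passes the parameters on.\<close>
  let ?g = "\<lambda>ys. rec_nat (z (tl ys)) (\<lambda>i r. s (i # r # tl ys)) (hd ys)"
  let ?fs = "n # map (\<lambda>i xs. xs ! i) [0..<k]"
  have "recursive (length ?fs) ?g"
    unfolding recursive_def
    by (rule exI[of _ "PrimRec rz rs"]) (use * in \<open>auto simp: length_Suc_conv\<close>)
  then have "recursive k (\<lambda>xs. ?g (map (\<lambda>f. f xs) ?fs))"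
    by (rule recursive_comp) (auto intro: recursive_proj assms)
  then show ?thesis
  proof (rule recursive_cong)
    fix xs :: "nat list" assume "length xs = k"
    then have "map (\<lambda>f. f xs) ?fs = n xs # xs"
      by (auto intro!: nth_equalityI simp: nth_Cons split: nat.split)
    then show "?g (map (\<lambda>f. f xs) ?fs) = rec_nat (z xs) (\<lambda>i r. s (i # r # xs)) (n xs)" by simp
  qed
qed

lemma recursive_Suc: assumes "recursive k f" shows "recursive k (\<lambda>xs. Suc (f xs))"
proof -
  have "recursive (length [f]) (\<lambda>ys. Suc (hd ys))"
    unfolding recursive_def
    by (rule exI[of _ Succ]) (auto simp: length_Suc_conv intro: computes.succ)
  from recursive_comp[OF this] assms show ?thesis by simp
qed

lemma recursive_const: "recursive k (\<lambda>_. n)"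
proof (induction n)
  case 0 then show ?case unfolding recursive_def using computes.zero by blast
qed (rule recursive_Suc)

section \<open>Binary functions and elementary arithmetic\<close>

definition recursive2 :: "(nat \<Rightarrow> nat \<Rightarrow> nat) \<Rightarrow> bool" where
  "recursive2 g \<longleftrightarrow> recursive 2 (\<lambda>xs. g (xs ! 0) (xs ! 1))"

lemma recursive2_comp:
  assumes "recursive2 g" "recursive k f1" "recursive k f2"
  shows "recursive k (\<lambda>xs. g (f1 xs) (f2 xs))"
  using recursive_comp[of "[f1, f2]" "\<lambda>xs. g (xs ! 0) (xs ! 1)" k] assms
  by (simp add: recursive2_def numeral_2_eq_2)

text \<open>Recursion whose step does not see the parameters. It yields all the arithmetic below;
  the bounded quantifier uses \<open>recursive_prim\<close> itself.\<close>

lemma recursive2_rec: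
  assumes "recursive2 s" "recursive k n" "recursive k z"
  shows "recursive k (\<lambda>xs. rec_nat (z xs) (\<lambda>i r. s i r) (n xs))"
proof -
  have "recursive (Suc (Suc k)) (\<lambda>xs. s (xs ! 0) (xs ! 1))"
    by (rule recursive2_comp[OF assms(1)]) (auto intro: recursive_proj)
  from recursive_prim[OF assms(2,3) this] show ?thesis by simp
qed

lemma recursive2_nth: "recursive 2 (\<lambda>xs. xs ! 0)" "recursive 2 (\<lambda>xs. xs ! 1)"
  by (auto intro: recursive_proj)

lemma recursive2_add: "recursive2 (+)"
proof -
  have s: "recursive2 (\<lambda>i r. Suc r)"
    unfolding recursive2_def by (intro recursive_Suc recursive2_nth)
  have "rec_nat y (\<lambda>i r. Suc r) x = x + y" for x y by (induction x) auto
  with recursive2_rec[OF s recursive2_nth] show ?thesis by (simp add: recursive2_def)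
qed

lemmas recursive_add = recursive2_comp[OF recursive2_add]

lemma recursive_pred: assumes "recursive k f" shows "recursive k (\<lambda>xs. f xs - 1)"
proof -
  have s: "recursive2 (\<lambda>i r. i)"
    unfolding recursive2_def by (rule recursive2_nth)
  have "rec_nat 0 (\<lambda>i r. i) x = x - 1" for x by (cases x) auto
  with recursive2_rec[OF s assms recursive_const[of k 0]] show ?thesis by simp
qed

lemma recursive2_diff: "recursive2 (-)"
proof -
  have s: "recursive2 (\<lambda>i r. r - 1)"
    unfolding recursive2_def by (intro recursive_pred recursive2_nth)
  have "rec_nat x (\<lambda>i r. r - 1) y = x - y" for x y by (induction y) auto
  with recursive2_rec[OF s recursive2_nth(2,1)] show ?thesis by (simp add: recursive2_def)
qed

lemmas recursive_diff = recursive2_comp[OF recursive2_diff]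

lemma recursive_triangle: assumes "recursive k f" shows "recursive k (\<lambda>xs. triangle (f xs))"
proof -
  have s: "recursive2 (\<lambda>i r. r + Suc i)"
    unfolding recursive2_def by (intro recursive_add recursive_Suc recursive2_nth)
  have "rec_nat 0 (\<lambda>i r. r + Suc i) x = triangle x" for x by (induction x) auto
  with recursive2_rec[OF s assms recursive_const[of k 0]] show ?thesis by simp
qed

lemma recursive_prod_encode:
  "recursive k f \<Longrightarrow> recursive k g \<Longrightarrow> recursive k (\<lambda>xs. prod_encode (f xs, g xs))"
  unfolding prod_encode_def by (simp add: recursive_add recursive_triangle)

lemma recursive_pow2: assumes "recursive k f" shows "recursive k (\<lambda>xs. 2 ^ f xs)"
proof -
  have s: "recursive2 (\<lambda>i r. r + r)"
    unfolding recursive2_def by (intro recursive_add recursive2_nth)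
  have "rec_nat 1 (\<lambda>i r. r + r) x = (2 :: nat) ^ x" for x by (induction x) auto
  with recursive2_rec[OF s assms recursive_const[of k 1]] show ?thesis by simp
qed

lemma recursive_mod2: assumes "recursive k f" shows "recursive k (\<lambda>xs. f xs mod 2)"
proof -
  have s: "recursive2 (\<lambda>i r. 1 - r)"
    unfolding recursive2_def by (intro recursive_diff recursive_const recursive2_nth)
  have "rec_nat 0 (\<lambda>i r. 1 - r) x = x mod 2" for x :: nat by (induction x) (simp, simp, presburger)
  with recursive2_rec[OF s assms recursive_const[of k 0]] show ?thesis by simp
qed

lemma recursive_div2: assumes "recursive k f" shows "recursive k (\<lambda>xs. f xs div 2)"
proof -
  have s: "recursive2 (\<lambda>i r. r + i mod 2)"
    unfolding recursive2_def by (intro recursive_add recursive_mod2 recursive2_nth)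
  have "rec_nat 0 (\<lambda>i r. r + i mod 2) x = x div 2" for x :: nat by (induction x) (simp, simp, presburger)
  with recursive2_rec[OF s assms recursive_const[of k 0]] show ?thesis by simp
qed

lemma recursive_div_pow2:
  assumes "recursive k f" "recursive k g"
  shows "recursive k (\<lambda>xs. f xs div 2 ^ g xs)"
proof -
  have s: "recursive2 (\<lambda>i r. r div 2)"
    unfolding recursive2_def by (intro recursive_div2 recursive2_nth)
  have "rec_nat x (\<lambda>i r. r div 2) y = x div 2 ^ y" for x y :: nat
    by (induction y) (auto simp: div_mult2_eq mult.commute[of 2])
  with recursive2_rec[OF s assms(2,1)] show ?thesis by simp
qed

section \<open>Recursive predicates and bounded quantification\<close>

definition recursive_predicate :: "nat \<Rightarrow> (nat list \<Rightarrow> bool) \<Rightarrow> bool" where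
  "recursive_predicate k P \<longleftrightarrow> recursive k (\<lambda>xs. of_bool (P xs))"

lemma recursive_predicate_cong:
  "recursive_predicate k P \<Longrightarrow> (\<And>xs. length xs = k \<Longrightarrow> P xs \<longleftrightarrow> Q xs) \<Longrightarrow> recursive_predicate k Q"
  unfolding recursive_predicate_def by (erule recursive_cong) simp

text \<open>With truncated subtraction \<open>1 - (a - b)\<close> is the truth value of
  \<open>a \<le> b\<close>; on truth values the same expression is implication.\<close>

lemma recursive_predicate_le:
  "recursive k f \<Longrightarrow> recursive k g \<Longrightarrow> recursive_predicate k (\<lambda>xs. f xs \<le> g xs)"
  unfolding recursive_predicate_def
  by (rule recursive_cong[OF recursive_diff[OF recursive_const[of _ 1] recursive_diff[of k f g]]]) auto

lemma recursive_predicate_imp: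
  "recursive_predicate k P \<Longrightarrow> recursive_predicate k Q \<Longrightarrow> recursive_predicate k (\<lambda>xs. P xs \<longrightarrow> Q xs)"
  unfolding recursive_predicate_def
  by (rule recursive_cong[OF recursive_diff[OF recursive_const[of _ 1]
        recursive_diff[of k "\<lambda>xs. of_bool (P xs)" "\<lambda>xs. of_bool (Q xs)"]]]) auto

lemma recursive_predicate_True: "recursive_predicate k (\<lambda>_. True)"
  unfolding recursive_predicate_def by (rule recursive_const)

lemma recursive_predicate_conj:
  assumes "recursive_predicate k P" "recursive_predicate k Q"
  shows "recursive_predicate k (\<lambda>xs. P xs \<and> Q xs)"
proof -
  have "recursive_predicate k (\<lambda>xs. 2 \<le> of_bool (P xs) + (of_bool (Q xs) :: nat))"
    using assms unfolding recursive_predicate_def[of k P] recursive_predicate_def[of k Q]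
    by (intro recursive_predicate_le recursive_add recursive_const)
  then show ?thesis by (rule recursive_predicate_cong) auto
qed

lemma recursive_predicate_ball:
  "(\<And>x. x \<in> set l \<Longrightarrow> recursive_predicate k (P x)) \<Longrightarrow> recursive_predicate k (\<lambda>xs. \<forall>x\<in>set l. P x xs)"
  by (induction l) (auto intro: recursive_predicate_True recursive_predicate_conj)

text \<open>Bit \<open>n\<close> of \<open>T\<close> expresses membership of \<open>n\<close> in the
  finite set coded by \<open>T\<close>.\<close>

lemma recursive_predicate_bit:
  assumes "recursive k f" "recursive k g"
  shows "recursive_predicate k (\<lambda>xs. odd (f xs div 2 ^ g xs))"
  using recursive_mod2[OF recursive_div_pow2[OF assms]]
  unfolding recursive_predicate_def by (simp add: of_bool_odd_eq_mod_2)

lemma recursive_predicate_all_less: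
  assumes "recursive k n" "recursive_predicate (Suc k) P"
  shows "recursive_predicate k (\<lambda>xs. \<forall>y<n xs. P (y # xs))"
proof -
  \<comment> \<open>The step function receives counter, accumulated value and parameters; these
    projections skip index 1, since \<open>P\<close> expects the counter followed by the
    parameters.\<close>
  let ?fs = "map (\<lambda>i xs. xs ! i) (0 # [2..<Suc (Suc k)])"
  have "recursive (length ?fs) (\<lambda>xs. of_bool (P xs))"
    using assms(2) by (simp add: recursive_predicate_def del: upt_Suc)
  then have "recursive (Suc (Suc k)) (\<lambda>xs. of_bool (P (map (\<lambda>f. f xs) ?fs)))"
    by (rule recursive_comp) (auto intro: recursive_proj)
  then have "recursive (Suc (Suc k)) (\<lambda>xs. of_bool (P (hd xs # drop 2 xs)))"
  proof (rule recursive_cong)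
    fix xs :: "nat list" assume l: "length xs = Suc (Suc k)"
    then obtain a b zs where "xs = a # b # zs" by (auto simp: length_Suc_conv)
    then have "map (\<lambda>f. f xs) ?fs = hd xs # drop 2 xs"
      using l by (auto intro!: nth_equalityI simp del: upt_Suc)
    then show "of_bool (P (map (\<lambda>f. f xs) ?fs)) = of_bool (P (hd xs # drop 2 xs))" by simp
  qed
  \<comment> \<open>The accumulated truth value and that of \<open>P\<close> at the counter add up
    to 2 exactly when both hold.\<close>
  then have "recursive_predicate (Suc (Suc k)) (\<lambda>xs. 2 \<le> xs ! 1 + of_bool (P (hd xs # drop 2 xs)))"
    by (intro recursive_predicate_le recursive_add recursive_const recursive_proj) auto
  then have "recursive k (\<lambda>xs. rec_nat 1
      (\<lambda>i r. of_bool (2 \<le> (i # r # xs) ! 1 + of_bool (P (hd (i # r # xs) # drop 2 (i # r # xs))))) (n xs))"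
    unfolding recursive_predicate_def
    by (rule recursive_prim[OF assms(1) recursive_const[of _ 1]])
  moreover have "rec_nat 1 (\<lambda>i r. of_bool (2 \<le> (i # r # xs) ! 1
      + of_bool (P (hd (i # r # xs) # drop 2 (i # r # xs))))) m = (of_bool (\<forall>y<m. P (y # xs)) :: nat)"
    for m xs by (induction m) (auto simp: less_Suc_eq)
  ultimately show ?thesis unfolding recursive_predicate_def by simp
qed

text \<open>A block of \<open>m\<close> quantifiers is peeled off one at a time. The bound is the
  last argument because prepending quantified values leaves the last entry of a nonempty list
  unchanged.\<close>

lemma recursive_predicate_all_lists:
  assumes "recursive_predicate (m + k) P" "0 < k"
  shows "recursive_predicate k
    (\<lambda>xs. \<forall>ys. length ys = m \<longrightarrow> (\<forall>y\<in>set ys. y \<le> last xs) \<longrightarrow> P (ys @ xs))"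
  using assms
proof (induction m arbitrary: k)
  case 0
  then show ?case by simp
next
  case (Suc m)
  have "recursive k (\<lambda>xs. Suc (xs ! (k - 1)))"
    using Suc.prems by (intro recursive_Suc recursive_proj) auto
  moreover have "recursive_predicate (Suc k)
      (\<lambda>xs. \<forall>ys. length ys = m \<longrightarrow> (\<forall>y\<in>set ys. y \<le> last xs) \<longrightarrow> P (ys @ xs))"
    using Suc.IH[of "Suc k"] Suc.prems by simp
  ultimately have "recursive_predicate k (\<lambda>xs. \<forall>z<Suc (xs ! (k - 1)).
      \<forall>ys. length ys = m \<longrightarrow> (\<forall>y\<in>set ys. y \<le> last (z # xs)) \<longrightarrow> P (ys @ z # xs))"
    by (rule recursive_predicate_all_less)
  then show ?case
  proof (rule recursive_predicate_cong)
    fix xs :: "nat list" assume l: "length xs = k"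
    then have "xs \<noteq> []" using Suc.prems(2) by auto
    then have last: "xs ! (k - 1) = last xs" "\<And>z. last (z # xs) = last xs"
      using l by (auto simp: last_conv_nth)
    show "(\<forall>z<Suc (xs ! (k - 1)). \<forall>ys. length ys = m \<longrightarrow>
          (\<forall>y\<in>set ys. y \<le> last (z # xs)) \<longrightarrow> P (ys @ z # xs)) \<longleftrightarrow>
        (\<forall>ys. length ys = Suc m \<longrightarrow> (\<forall>y\<in>set ys. y \<le> last xs) \<longrightarrow> P (ys @ xs))" (is "?L \<longleftrightarrow> ?R")
    proof
      assume L: ?L
      show ?R
      proof (intro allI impI)
        fix ys :: "nat list" assume ys: "length ys = Suc m" "\<forall>y\<in>set ys. y \<le> last xs"
        \<comment> \<open>The outermost quantifier supplies the last entry of \<open>ys\<close>; the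
          induction hypothesis prepends the others.\<close>
        then obtain zs z where "ys = zs @ [z]" by (cases ys rule: rev_cases) auto
        then show "P (ys @ xs)" using L ys last by simp
      qed
    next
      assume R: ?R
      show ?L
      proof (intro allI impI)
        fix z ys assume "z < Suc (xs ! (k - 1))" "length ys = m" "\<forall>y\<in>set ys. y \<le> last (z # xs)"
        then have "length (ys @ [z]) = Suc m" "\<forall>y\<in>set (ys @ [z]). y \<le> last xs"
          unfolding last by (auto simp: less_Suc_eq_le)
        with R have "P ((ys @ [z]) @ xs)" by blast
        then show "P (ys @ z # xs)" by simp
      qed
    qed
  qed
qed

section \<open>Horn clauses over codes\<close>

text \<open>With the rules represented as data, recursiveness of derivability is proved once for
  arbitrary clause lists.\<close>

datatype tm = V nat | N nat | TPair tm tm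

primrec ev :: "nat list \<Rightarrow> tm \<Rightarrow> nat" where
  "ev xs (V i) = xs ! i"
| "ev xs (N n) = n"
| "ev xs (TPair s t) = prod_encode (ev xs s, ev xs t)"

primrec tm_vars_less :: "nat \<Rightarrow> tm \<Rightarrow> bool" where
  "tm_vars_less k (V i) \<longleftrightarrow> i < k"
| "tm_vars_less k (N n) \<longleftrightarrow> True"
| "tm_vars_less k (TPair s t) \<longleftrightarrow> tm_vars_less k s \<and> tm_vars_less k t"

lemma ev_append: "tm_vars_less (length ys) t \<Longrightarrow> ev (ys @ xs) t = ev ys t"
  by (induction t) (auto simp: nth_append)

lemma recursive_ev: "tm_vars_less m t \<Longrightarrow> m \<le> k \<Longrightarrow> recursive k (\<lambda>xs. ev xs t)"
  by (induction t) (auto intro: recursive_proj recursive_const recursive_prod_encode)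

type_synonym clause = "tm list \<times> tm"

text \<open>The guard on the conclusion allows a subset of \<open>{..B}\<close> to be closed
  although instances of clauses may have conclusions above \<open>B\<close>.\<close>

definition holds :: "nat \<Rightarrow> (nat \<Rightarrow> bool) \<Rightarrow> nat list \<Rightarrow> clause \<Rightarrow> bool" where
  "holds B M ys q = ((\<forall>p\<in>set (fst q). M (ev ys p)) \<longrightarrow> ev ys (snd q) \<le> B \<longrightarrow> M (ev ys (snd q)))"

definition closed :: "nat \<Rightarrow> clause list \<Rightarrow> nat \<Rightarrow> (nat \<Rightarrow> bool) \<Rightarrow> bool" where
  "closed m cls B M \<longleftrightarrow>
    (\<forall>ys. length ys = m \<longrightarrow> (\<forall>y\<in>set ys. y \<le> B) \<longrightarrow> (\<forall>q\<in>set cls. holds B M ys q))"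

text \<open>The bits of \<open>T\<close> range over all subsets of \<open>{..B}\<close>, so this is the least fixed point of
  the clauses, relativised to \<open>{..B}\<close>.\<close>

definition horn_derivable :: "nat \<Rightarrow> clause list \<Rightarrow> nat \<Rightarrow> nat \<Rightarrow> bool" where
  "horn_derivable m cls B n \<longleftrightarrow>
    (\<forall>T<2 ^ Suc B. closed m cls B (\<lambda>i. i \<in> set_decode T) \<longrightarrow> n \<in> set_decode T)"

lemma recursive_horn_derivable:
  assumes wf: "\<forall>(ps, c)\<in>set cls. tm_vars_less m c \<and> (\<forall>p\<in>set ps. tm_vars_less m p)"
    and f: "recursive 1 f" and g: "recursive 1 g"
  shows "recursive_predicate 1 (\<lambda>xs. horn_derivable m cls (f xs) (g xs))"
proof -
  \<comment> \<open>The argument list holds the \<open>m\<close> clause variables, then the set code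
    \<open>T\<close>, the number to be tested and \<open>B\<close>. The bound \<open>B\<close> comes
    last, as \<open>recursive_predicate_all_lists\<close> requires.\<close>
  let ?M = "\<lambda>xs n. odd (xs ! m div 2 ^ n)"
  have "recursive_predicate (m + 3) (\<lambda>xs. \<forall>q\<in>set cls. (\<forall>p\<in>set (fst q). ?M xs (ev xs p)) \<longrightarrow>
      ev xs (snd q) \<le> xs ! (m + 2) \<longrightarrow> ?M xs (ev xs (snd q)))"
    by (intro recursive_predicate_ball recursive_predicate_imp recursive_predicate_le
        recursive_predicate_bit recursive_ev[of m] recursive_proj) (use wf in fastforce)+
  then have "recursive_predicate 3 (\<lambda>xs. \<forall>ys. length ys = m \<longrightarrow> (\<forall>y\<in>set ys. y \<le> last xs) \<longrightarrow>
      (\<forall>q\<in>set cls. (\<forall>p\<in>set (fst q). ?M (ys @ xs) (ev (ys @ xs) p)) \<longrightarrow>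
        ev (ys @ xs) (snd q) \<le> (ys @ xs) ! (m + 2) \<longrightarrow> ?M (ys @ xs) (ev (ys @ xs) (snd q))))"
    by (rule recursive_predicate_all_lists) simp
  then have "recursive_predicate 3 (\<lambda>xs. closed m cls (xs ! 2) (\<lambda>i. i \<in> set_decode (xs ! 0)))"
  proof (rule recursive_predicate_cong)
    fix xs :: "nat list" assume "length xs = 3"
    then obtain T c B where xs: "xs = [T, c, B]"
      by (auto simp: numeral_3_eq_3 length_Suc_conv)
    have "ev (ys @ xs) (snd q) = ev ys (snd q)" "\<forall>p\<in>set (fst q). ev (ys @ xs) p = ev ys p"
      if "length ys = m" "q \<in> set cls" for ys q
      using wf that by (auto intro!: ev_append)
    then show "(\<forall>ys. length ys = m \<longrightarrow> (\<forall>y\<in>set ys. y \<le> last xs) \<longrightarrow>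
      (\<forall>q\<in>set cls. (\<forall>p\<in>set (fst q). ?M (ys @ xs) (ev (ys @ xs) p)) \<longrightarrow>
        ev (ys @ xs) (snd q) \<le> (ys @ xs) ! (m + 2) \<longrightarrow> ?M (ys @ xs) (ev (ys @ xs) (snd q)))) \<longleftrightarrow>
      closed m cls (xs ! 2) (\<lambda>i. i \<in> set_decode (xs ! 0))"
      unfolding closed_def holds_def by (auto simp: xs nth_append set_decode_def)
  qed
  then have "recursive_predicate (Suc 2) (\<lambda>xs. closed m cls (xs ! 2) (\<lambda>i. i \<in> set_decode (xs ! 0))
      \<longrightarrow> xs ! 1 \<in> set_decode (xs ! 0))"
    unfolding set_decode_def mem_Collect_eq
    by (intro recursive_predicate_imp recursive_predicate_bit recursive_proj) auto
  from recursive_predicate_all_less[OF recursive_pow2[OF recursive_Suc[OF recursive_proj[of 1]]] this]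
  have "recursive_predicate 2 (\<lambda>xs. horn_derivable m cls (xs ! 1) (xs ! 0))"
    by (simp add: horn_derivable_def)
  then have "recursive2 (\<lambda>x y. of_bool (horn_derivable m cls y x))"
    by (simp add: recursive2_def recursive_predicate_def)
  from recursive2_comp[OF this g f] show ?thesis by (simp add: recursive_predicate_def)
qed

lemma set_encode_less: "A \<subseteq> {..B} \<Longrightarrow> set_encode A < 2 ^ Suc B"
proof -
  assume "A \<subseteq> {..B}"
  then have "set_encode A \<le> (\<Sum>i\<in>{..B}. 2 ^ i)"
    unfolding set_encode_def by (intro sum_mono2) auto
  also have "\<dots> < 2 ^ Suc B" by (induction B) auto
  finally show ?thesis .
qed

text \<open>\<open>P\<close> may be undecidable: cut down to \<open>{..B}\<close> it is a finite
  set, so one of the codes \<open>T\<close> represents it.\<close>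

lemma horn_derivable_induct:
  assumes "horn_derivable m cls B n" "closed m cls B (\<lambda>i. i \<le> B \<and> P i)"
  shows "P n"
proof -
  let ?A = "{i. i \<le> B \<and> P i}"
  have A: "set_decode (set_encode ?A) = ?A" by simp
  have "set_encode ?A < 2 ^ Suc B" by (intro set_encode_less) auto
  with assms(1) have "closed m cls B (\<lambda>i. i \<in> set_decode (set_encode ?A)) \<longrightarrow>
      n \<in> set_decode (set_encode ?A)"
    unfolding horn_derivable_def by blast
  then show ?thesis using assms(2) unfolding A by simp
qed

section \<open>The clauses of the cut-free calculus\<close>

abbreviation "tF t \<equiv> TPair (N 0) t"
abbreviation "tComma s t \<equiv> TPair (N 1) (TPair s t)"
abbreviation "tSemi s t \<equiv> TPair (N 2) (TPair s t)"
abbreviation "tBot \<equiv> TPair (N 1) (N 0)"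
abbreviation "tOp k s t \<equiv> TPair (N k) (TPair s t)"
abbreviation "tSeq s t \<equiv> TPair (N 0) (TPair s t)"
abbreviation "tStep s t u \<equiv> TPair (N 1) (TPair s (TPair t u))"

text \<open>The clauses follow the order of the introduction rules of \<open>cf\<close> and
  \<open>lstep\<close>, with the tags of the Goedel numbering; the outermost tag is 0 for sequents
  and 1 for steps. Variables range over all numbers, whether codes of formulas, of structures or of
  neither.\<close>

definition clauses :: "clause list" where
  "clauses =
   (let x = V 0; y = V 1; z = V 2; w = V 3 in
   [([], tSeq (tF x) x),
    ([tStep x y z, tSeq x w, tSeq y w], tSeq z w),
    ([tSeq x z, tSeq y w], tSeq (tComma x y) (tOp 2 z w)),
    ([tSeq x z, tSeq y w], tSeq (tSemi x y) (tOp 6 z w)),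
    ([tSeq (tComma (tF z) x) w], tSeq x (tOp 3 z w)),
    ([tSeq (tSemi (tF z) x) w], tSeq x (tOp 7 z w)),
    ([tSeq x z, tSeq x w], tSeq x (tOp 4 z w)),
    ([tSeq x z], tSeq x (tOp 5 z w)),
    ([tSeq x w], tSeq x (tOp 5 z w)),
    ([tSeq x tBot], tSeq x z),
    ([tSeq x tBot], tSeq (tComma x y) tBot),
    ([tSeq x tBot], tSeq (tComma y x) tBot),
    ([tSeq x tBot], tSeq (tSemi x y) tBot),
    ([tSeq x tBot], tSeq (tSemi y x) tBot),
    ([tSeq (tSemi (tComma x y) z) tBot], tSeq (tSemi (tComma x z) y) tBot),
    ([], tStep (tComma (tF z) (tF w)) (tComma (tF z) (tF w)) (tF (tOp 2 z w))),
    ([], tStep (tSemi (tF z) (tF w)) (tSemi (tF z) (tF w)) (tF (tOp 6 z w))),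
    ([tSeq x z], tStep (tF w) (tF w) (tComma x (tF (tOp 3 z w)))),
    ([tSeq x z], tStep (tF w) (tF w) (tSemi x (tF (tOp 7 z w)))),
    ([], tStep (tF z) (tF z) (tF (tOp 4 z w))),
    ([], tStep (tF w) (tF w) (tF (tOp 4 z w))),
    ([], tStep (tF z) (tF w) (tF (tOp 5 z w))),
    ([], tStep (tComma x y) (tComma x y) (tComma y x)),
    ([], tStep (tSemi x y) (tSemi x y) (tSemi y x)),
    ([], tStep (tComma x (tComma y z)) (tComma x (tComma y z)) (tComma (tComma x y) z)),
    ([], tStep (tComma (tComma x y) z) (tComma (tComma x y) z) (tComma x (tComma y z))),
    ([tStep x y z], tStep (tComma x w) (tComma y w) (tComma z w)),
    ([tStep x y z], tStep (tComma w x) (tComma w y) (tComma w z)),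
    ([tStep x y z], tStep (tSemi x w) (tSemi y w) (tSemi z w)),
    ([tStep x y z], tStep (tSemi w x) (tSemi w y) (tSemi w z))])"

lemma clauses_vars:
  "\<forall>(ps, c)\<in>set clauses. tm_vars_less 4 c \<and> (\<forall>p\<in>set ps. tm_vars_less 4 p)"
  by (simp add: clauses_def Let_def)

lemma closed_clausesD:
  assumes "closed 4 clauses B M" "x \<le> B" "y \<le> B" "z \<le> B" "w \<le> B" "i < 30"
  shows "holds B M [x, y, z, w] (clauses ! i)"
proof -
  have "length clauses = 30" by (simp add: clauses_def Let_def)
  then have "clauses ! i \<in> set clauses" using assms(6) by (metis nth_mem)
  moreover have "length [x, y, z, w] = 4" "\<forall>u\<in>set [x, y, z, w]. u \<le> B" using assms by auto
  ultimately show ?thesis using assms(1) unfolding closed_def by blast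
qed

subsection \<open>Bounds on codes\<close>

text \<open>With these weights no premise of the local calculus is heavier than its conclusion: a
  connective outweighs the structural connective and the two \<open>F\<close> nodes that replace it.\<close>

primrec fweight :: "form \<Rightarrow> nat" where
  "fweight (Var n) = 1"
| "fweight \<^bold>\<bottom> = 1"
| "fweight (a \<^bold>\<cdot> b) = 2 + fweight a + fweight b"
| "fweight (a \<^bold>\<setminus> b) = 2 + fweight a + fweight b"
| "fweight (a \<^bold>\<and> b) = 2 + fweight a + fweight b"
| "fweight (a \<^bold>\<or> b) = 2 + fweight a + fweight b"
| "fweight (a \<^bold>* b) = 2 + fweight a + fweight b"
| "fweight (a \<^bold>\<rightarrow> b) = 2 + fweight a + fweight b"

primrec sweight :: "struc \<Rightarrow> nat" where
  "sweight (F a) = 1 + fweight a"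
| "sweight (X \<^bold>, Y) = 1 + sweight X + sweight Y"
| "sweight (X \<^bold>; Y) = 1 + sweight X + sweight Y"

text \<open>Weight alone does not bound a code, since every variable weighs 1; the largest variable
  index must be bounded as well.\<close>

primrec fvars_le :: "nat \<Rightarrow> form \<Rightarrow> bool" where
  "fvars_le v (Var n) \<longleftrightarrow> n \<le> v"
| "fvars_le v \<^bold>\<bottom> \<longleftrightarrow> True"
| "fvars_le v (a \<^bold>\<cdot> b) \<longleftrightarrow> fvars_le v a \<and> fvars_le v b"
| "fvars_le v (a \<^bold>\<setminus> b) \<longleftrightarrow> fvars_le v a \<and> fvars_le v b"
| "fvars_le v (a \<^bold>\<and> b) \<longleftrightarrow> fvars_le v a \<and> fvars_le v b"
| "fvars_le v (a \<^bold>\<or> b) \<longleftrightarrow> fvars_le v a \<and> fvars_le v b"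
| "fvars_le v (a \<^bold>* b) \<longleftrightarrow> fvars_le v a \<and> fvars_le v b"
| "fvars_le v (a \<^bold>\<rightarrow> b) \<longleftrightarrow> fvars_le v a \<and> fvars_le v b"

primrec svars_le :: "nat \<Rightarrow> struc \<Rightarrow> bool" where
  "svars_le v (F a) \<longleftrightarrow> fvars_le v a"
| "svars_le v (X \<^bold>, Y) \<longleftrightarrow> svars_le v X \<and> svars_le v Y"
| "svars_le v (X \<^bold>; Y) \<longleftrightarrow> svars_le v X \<and> svars_le v Y"

lemma fweight_pos: "0 < fweight a"
  by (cases a) auto

lemma prod_encode_ge_add: "a + b \<le> prod_encode (a, b)"
proof -
  have "n \<le> triangle n" for n by (induction n) auto
  from this[of "a + b"] show ?thesis by (simp add: prod_encode_def)
qed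

lemma prod_encode_mono: "a \<le> a' \<Longrightarrow> b \<le> b' \<Longrightarrow> prod_encode (a, b) \<le> prod_encode (a', b')"
proof -
  have "m \<le> n \<Longrightarrow> triangle m \<le> triangle n" for m n
    by (induction n) (auto simp: le_Suc_eq)
  then show "a \<le> a' \<Longrightarrow> b \<le> b' \<Longrightarrow> prod_encode (a, b) \<le> prod_encode (a', b')"
    by (simp add: prod_encode_def add_mono)
qed

lemma prod_encode_ge_add3: "t + a + b \<le> prod_encode (t, prod_encode (a, b))"
  using prod_encode_ge_add[of t "prod_encode (a, b)"] prod_encode_ge_add[of a b] by linarith

lemma fweight_le_code: "fweight a \<le> 3 * form_code a + 1"
proof (induction a)
  case (Fus a b)
  then show ?case using prod_encode_ge_add3[of 2 "form_code a" "form_code b"] by simp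
next
  case (Under a b)
  then show ?case using prod_encode_ge_add3[of 3 "form_code a" "form_code b"] by simp
next
  case (Conj a b)
  then show ?case using prod_encode_ge_add3[of 4 "form_code a" "form_code b"] by simp
next
  case (Disj a b)
  then show ?case using prod_encode_ge_add3[of 5 "form_code a" "form_code b"] by simp
next
  case (Star a b)
  then show ?case using prod_encode_ge_add3[of 6 "form_code a" "form_code b"] by simp
next
  case (Arr a b)
  then show ?case using prod_encode_ge_add3[of 7 "form_code a" "form_code b"] by simp
qed auto

text \<open>For a comma the tag 1 contributes 3 after scaling, which pays for the node and for the
  second additive constant:
  \<open>3 * (1 + x + y) + 2 = 1 + (3 * x + 2) + (3 * y + 2)\<close>.\<close>

lemma sweight_le_code: "sweight X \<le> 3 * struc_code X + 2"
proof (induction X)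
  case (F a)
  then show ?case
    using prod_encode_ge_add[of 0 "form_code a"] fweight_le_code[of a] by simp
next
  case (Comma X Y)
  then show ?case using prod_encode_ge_add3[of 1 "struc_code X" "struc_code Y"] by simp
next
  case (Semi X Y)
  then show ?case using prod_encode_ge_add3[of 2 "struc_code X" "struc_code Y"] by simp
qed

lemma fvars_le_mono: "fvars_le v a \<Longrightarrow> v \<le> v' \<Longrightarrow> fvars_le v' a"
  by (induction a) auto

lemma svars_le_mono: "svars_le v X \<Longrightarrow> v \<le> v' \<Longrightarrow> svars_le v' X"
  by (induction X) (auto intro: fvars_le_mono)

lemma prod_encode_components:
  "a \<le> prod_encode (t, prod_encode (a, b))" "b \<le> prod_encode (t, prod_encode (a, b))"
  using prod_encode_ge_add3[of t a b] by auto

lemma fvars_le_code: "fvars_le (form_code a) a"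
  by (induction a)
    (auto intro: fvars_le_mono[OF _ prod_encode_components(1)]
      fvars_le_mono[OF _ prod_encode_components(2)] le_prod_encode_2)

lemma svars_le_code: "svars_le (struc_code X) X"
  by (induction X)
    (auto intro: svars_le_mono[OF _ prod_encode_components(1)]
      svars_le_mono[OF _ prod_encode_components(2)]
      fvars_le_mono[OF fvars_le_code le_prod_encode_2])

text \<open>Starting from the bound \<open>v\<close> on variable indices, each round dominates every
  node with a tag up to 8 whose children lie below the previous value. All tags in use are at most
  7.\<close>

definition code_bound :: "nat \<Rightarrow> nat \<Rightarrow> nat" where
  "code_bound v n = rec_nat v (\<lambda>_ r. prod_encode (8, prod_encode (r, r))) n"

lemma code_bound_Suc:
  "code_bound v (Suc n) = prod_encode (8, prod_encode (code_bound v n, code_bound v n))"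
  by (simp add: code_bound_def)

lemma recursive_code_bound:
  "recursive k f \<Longrightarrow> recursive k g \<Longrightarrow> recursive k (\<lambda>xs. code_bound (f xs) (g xs))"
proof -
  have "recursive2 (\<lambda>i r. prod_encode (8, prod_encode (r, r)))"
    unfolding recursive2_def by (intro recursive_prod_encode recursive_const recursive2_nth)
  then show "recursive k f \<Longrightarrow> recursive k g \<Longrightarrow> recursive k (\<lambda>xs. code_bound (f xs) (g xs))"
    unfolding code_bound_def by (rule recursive2_rec)
qed

lemma code_bound_mono: "m \<le> n \<Longrightarrow> code_bound v m \<le> code_bound v n"
  by (rule lift_Suc_mono_le[of "code_bound v"]) (auto simp: code_bound_Suc prod_encode_components)

lemma code_bound_node:
  assumes "t \<le> 8" "a \<le> code_bound v (n - 1)" "b \<le> code_bound v (n - 1)" "0 < n"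
  shows "prod_encode (t, prod_encode (a, b)) \<le> code_bound v n"
proof -
  obtain m where "n = Suc m" using assms(4) by (cases n) auto
  then show ?thesis
    using assms by (auto simp: code_bound_Suc intro!: prod_encode_mono)
qed

lemma code_bound_leaf:
  assumes "t \<le> 8" "a \<le> code_bound v (n - 1)" "0 < n"
  shows "prod_encode (t, a) \<le> code_bound v n"
proof -
  have "prod_encode (t, a) \<le> prod_encode (t, prod_encode (a, 0))"
    by (intro prod_encode_mono le_prod_encode_1) simp
  also have "\<dots> \<le> code_bound v n" using assms by (intro code_bound_node) auto
  finally show ?thesis .
qed

lemma le_code_bound: "v \<le> code_bound v n"
  using code_bound_mono[of 0 n v] by (simp add: code_bound_def)

text \<open>Immediate subformulas weigh less, so one round of \<open>code_bound\<close> per unit of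
  weight suffices.\<close>

lemma form_code_le: "fvars_le v a \<Longrightarrow> fweight a \<le> n \<Longrightarrow> form_code a \<le> code_bound v n"
proof (induction a arbitrary: n)
  case (Var k)
  then show ?case using order_trans[OF _ le_code_bound]
    by (auto intro!: code_bound_leaf)
next
  case Bot
  then show ?case by (auto intro!: code_bound_leaf)
qed (auto intro!: code_bound_node)

lemma struc_code_le: "svars_le v X \<Longrightarrow> sweight X \<le> n \<Longrightarrow> struc_code X \<le> code_bound v n"
proof (induction X arbitrary: n)
  case (F a)
  then show ?case by (auto intro!: code_bound_leaf form_code_le)
qed (auto intro!: code_bound_node)

subsection \<open>Cut-free derivations give Horn derivations\<close>

abbreviation seq_code :: "struc \<Rightarrow> form \<Rightarrow> nat" where
  "seq_code X a \<equiv> prod_encode (0, prod_encode (struc_code X, form_code a))"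

abbreviation step_code :: "struc \<Rightarrow> struc \<Rightarrow> struc \<Rightarrow> nat" where
  "step_code X Y Z \<equiv>
    prod_encode (1, prod_encode (struc_code X, prod_encode (struc_code Y, struc_code Z)))"

lemma seq_code_le:
  assumes "sweight X \<le> n" "fweight a \<le> n" "svars_le v X" "fvars_le v a"
  shows "seq_code X a \<le> code_bound v (n + 2)"
  using assms by (intro code_bound_node) (auto intro!: form_code_le struc_code_le)

text \<open>A triple is nested one pairing deeper than a sequent, which takes up both extra
  rounds.\<close>

lemma step_code_le:
  assumes "sweight X \<le> n" "sweight Y \<le> n" "sweight Z \<le> n"
    "svars_le v X" "svars_le v Y" "svars_le v Z"
  shows "step_code X Y Z \<le> code_bound v (n + 2)"
proof (intro code_bound_node)
  show "struc_code X \<le> code_bound v (n + 2 - 1)" using assms by (intro struc_code_le) auto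
  have "prod_encode (struc_code Y, struc_code Z) \<le> prod_encode (code_bound v n, code_bound v n)"
    using assms by (intro prod_encode_mono struc_code_le)
  also have "\<dots> \<le> code_bound v (n + 2 - 1)" by (simp add: code_bound_Suc le_prod_encode_2)
  finally show "prod_encode (struc_code Y, struc_code Z) \<le> code_bound v (n + 2 - 1)" .
qed auto

lemmas clause_simps = holds_def clauses_def Let_def form_code_le struc_code_le

text \<open>The total weight never grows from conclusion to premise, so a single \<open>n\<close>
  serves the whole derivation. The comparisons for \<open>lstep\<close> are stated without the bound
  \<open>n\<close> because the case of a left rule needs them to bound its upper sequents.\<close>

lemma cf_in_closed:
  assumes closed: "closed 4 clauses (code_bound v (n + 2)) M"
  shows "cf X a \<Longrightarrow> sweight X + fweight a \<le> n \<Longrightarrow> svars_le v X \<Longrightarrow> fvars_le v a \<Longrightarrow>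
      M (seq_code X a)"
    and "lstep X Y Z \<Longrightarrow>
      sweight X \<le> sweight Z \<and> sweight Y \<le> sweight Z \<and>
      (svars_le v Z \<longrightarrow> svars_le v X \<and> svars_le v Y) \<and>
      (sweight Z \<le> n \<longrightarrow> svars_le v Z \<longrightarrow> M (step_code X Y Z))"
proof (induction rule: cf_lstep.inducts)
  \<comment> \<open>Here and below the first four values instantiate the clause variables, with 0
    for those absent from the clause; the last number is the position of the clause.\<close>
  case (cf_Id a)
  then show ?case
    using closed_clausesD[OF closed, of "form_code a" 0 0 0 0]
      seq_code_le[of "F a" n "a" v]
    by (simp add: clause_simps)
next
  \<comment> \<open>The comparisons for the step carry the weight and variable bounds from
    \<open>Z\<close> over to \<open>X\<close> and \<open>Y\<close>.\<close>
  case (cf_left X Y Z c)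
  then show ?case
    using closed_clausesD[OF closed, of "struc_code X" "struc_code Y" "struc_code Z" "form_code c" 1]
      seq_code_le[of "Z" n "c" v] fweight_pos[of c]
    by (simp add: clause_simps)
next
  case (cf_FusR X a Y b)
  then show ?case
    using closed_clausesD[OF closed, of "struc_code X" "struc_code Y" "form_code a" "form_code b" 2]
      seq_code_le[of "X \<^bold>, Y" n "a \<^bold>\<cdot> b" v]
    by (simp add: clause_simps)
next
  case (cf_StarR X a Y b)
  then show ?case
    using closed_clausesD[OF closed, of "struc_code X" "struc_code Y" "form_code a" "form_code b" 3]
      seq_code_le[of "X \<^bold>; Y" n "a \<^bold>* b" v]
    by (simp add: clause_simps)
next
  case (cf_UnderR a X b)
  then show ?case
    using closed_clausesD[OF closed, of "struc_code X" 0 "form_code a" "form_code b" 4]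
      seq_code_le[of "X" n "a \<^bold>\<setminus> b" v]
    by (simp add: clause_simps)
next
  case (cf_ArrR a X b)
  then show ?case
    using closed_clausesD[OF closed, of "struc_code X" 0 "form_code a" "form_code b" 5]
      seq_code_le[of "X" n "a \<^bold>\<rightarrow> b" v]
    by (simp add: clause_simps)
next
  case (cf_ConjR X a b)
  then show ?case
    using closed_clausesD[OF closed, of "struc_code X" 0 "form_code a" "form_code b" 6]
      seq_code_le[of "X" n "a \<^bold>\<and> b" v]
    by (simp add: clause_simps)
next
  case (cf_DisjR1 X a b)
  then show ?case
    using closed_clausesD[OF closed, of "struc_code X" 0 "form_code a" "form_code b" 7]
      seq_code_le[of "X" n "a \<^bold>\<or> b" v]
    by (simp add: clause_simps)
next
  case (cf_DisjR2 X b a)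
  then show ?case
    using closed_clausesD[OF closed, of "struc_code X" 0 "form_code a" "form_code b" 8]
      seq_code_le[of "X" n "a \<^bold>\<or> b" v]
    by (simp add: clause_simps)
next
  \<comment> \<open>\<open>Bot\<close> has weight 1, the least possible, so replacing
    \<open>a\<close> by it cannot increase the weight.\<close>
  case (cf_Bot X a)
  then show ?case
    using closed_clausesD[OF closed, of "struc_code X" 0 "form_code a" 0 9]
      seq_code_le[of "X" n "a" v] fweight_pos[of a]
    by (simp add: clause_simps)
next
  case (cf_BotCommaL X W)
  then show ?case
    using closed_clausesD[OF closed, of "struc_code X" "struc_code W" 0 0 10]
      seq_code_le[of "X \<^bold>, W" n "\<^bold>\<bottom>" v]
    by (simp add: clause_simps)
next
  case (cf_BotCommaR X W)
  then show ?case
    using closed_clausesD[OF closed, of "struc_code X" "struc_code W" 0 0 11]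
      seq_code_le[of "W \<^bold>, X" n "\<^bold>\<bottom>" v]
    by (simp add: clause_simps)
next
  case (cf_BotSemiL X W)
  then show ?case
    using closed_clausesD[OF closed, of "struc_code X" "struc_code W" 0 0 12]
      seq_code_le[of "X \<^bold>; W" n "\<^bold>\<bottom>" v]
    by (simp add: clause_simps)
next
  case (cf_BotSemiR X W)
  then show ?case
    using closed_clausesD[OF closed, of "struc_code X" "struc_code W" 0 0 13]
      seq_code_le[of "W \<^bold>; X" n "\<^bold>\<bottom>" v]
    by (simp add: clause_simps)
next
  case (cf_RBot X Y Z)
  then show ?case
    using closed_clausesD[OF closed, of "struc_code X" "struc_code Y" "struc_code Z" 0 14]
      seq_code_le[of "(X \<^bold>, Z) \<^bold>; Y" n "\<^bold>\<bottom>" v]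
    by (simp add: clause_simps)
next
  case (ls_Fus a b)
  then show ?case
    using closed_clausesD[OF closed, of 0 0 "form_code a" "form_code b" 15]
      step_code_le[of "F a \<^bold>, F b" n "F a \<^bold>, F b" "F (a \<^bold>\<cdot> b)" v]
    by (simp add: clause_simps)
next
  case (ls_Star a b)
  then show ?case
    using closed_clausesD[OF closed, of 0 0 "form_code a" "form_code b" 16]
      step_code_le[of "F a \<^bold>; F b" n "F a \<^bold>; F b" "F (a \<^bold>* b)" v]
    by (simp add: clause_simps)
next
  case (ls_Under X a b)
  then show ?case
    using closed_clausesD[OF closed, of "struc_code X" 0 "form_code a" "form_code b" 17]
      step_code_le[of "F b" n "F b" "X \<^bold>, F (a \<^bold>\<setminus> b)" v]
    by (simp add: clause_simps)
next
  case (ls_Arr X a b)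
  then show ?case
    using closed_clausesD[OF closed, of "struc_code X" 0 "form_code a" "form_code b" 18]
      step_code_le[of "F b" n "F b" "X \<^bold>; F (a \<^bold>\<rightarrow> b)" v]
    by (simp add: clause_simps)
next
  case (ls_Conj1 a b)
  then show ?case
    using closed_clausesD[OF closed, of 0 0 "form_code a" "form_code b" 19]
      step_code_le[of "F a" n "F a" "F (a \<^bold>\<and> b)" v]
    by (simp add: clause_simps)
next
  case (ls_Conj2 b a)
  then show ?case
    using closed_clausesD[OF closed, of 0 0 "form_code a" "form_code b" 20]
      step_code_le[of "F b" n "F b" "F (a \<^bold>\<and> b)" v]
    by (simp add: clause_simps)
next
  case (ls_Disj a b)
  then show ?case
    using closed_clausesD[OF closed, of 0 0 "form_code a" "form_code b" 21]
      step_code_le[of "F a" n "F b" "F (a \<^bold>\<or> b)" v]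
    by (simp add: clause_simps)
next
  case (ls_Ex X Y)
  then show ?case
    using closed_clausesD[OF closed, of "struc_code X" "struc_code Y" 0 0 22]
      step_code_le[of "X \<^bold>, Y" n "X \<^bold>, Y" "Y \<^bold>, X" v]
    by (simp add: clause_simps)
next
  case (ls_ExSemi X Y)
  then show ?case
    using closed_clausesD[OF closed, of "struc_code X" "struc_code Y" 0 0 23]
      step_code_le[of "X \<^bold>; Y" n "X \<^bold>; Y" "Y \<^bold>; X" v]
    by (simp add: clause_simps)
next
  case (ls_As1 X Y Z)
  then show ?case
    using closed_clausesD[OF closed, of "struc_code X" "struc_code Y" "struc_code Z" 0 24]
      step_code_le[of "X \<^bold>, (Y \<^bold>, Z)" n "X \<^bold>, (Y \<^bold>, Z)" "(X \<^bold>, Y) \<^bold>, Z" v]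
    by (simp add: clause_simps)
next
  case (ls_As2 X Y Z)
  then show ?case
    using closed_clausesD[OF closed, of "struc_code X" "struc_code Y" "struc_code Z" 0 25]
      step_code_le[of "(X \<^bold>, Y) \<^bold>, Z" n "(X \<^bold>, Y) \<^bold>, Z" "X \<^bold>, (Y \<^bold>, Z)" v]
    by (simp add: clause_simps)
next
  case (ls_CommaL X Y Z W)
  then show ?case
    using closed_clausesD[OF closed, of "struc_code X" "struc_code Y" "struc_code Z" "struc_code W" 26]
      step_code_le[of "X \<^bold>, W" n "Y \<^bold>, W" "Z \<^bold>, W" v]
    by (simp add: clause_simps)
next
  case (ls_CommaR X Y Z W)
  then show ?case
    using closed_clausesD[OF closed, of "struc_code X" "struc_code Y" "struc_code Z" "struc_code W" 27]
      step_code_le[of "W \<^bold>, X" n "W \<^bold>, Y" "W \<^bold>, Z" v]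
    by (simp add: clause_simps)
next
  case (ls_SemiL X Y Z W)
  then show ?case
    using closed_clausesD[OF closed, of "struc_code X" "struc_code Y" "struc_code Z" "struc_code W" 28]
      step_code_le[of "X \<^bold>; W" n "Y \<^bold>; W" "Z \<^bold>; W" v]
    by (simp add: clause_simps)
next
  case (ls_SemiR X Y Z W)
  then show ?case
    using closed_clausesD[OF closed, of "struc_code X" "struc_code Y" "struc_code Z" "struc_code W" 29]
      step_code_le[of "W \<^bold>; X" n "W \<^bold>; Y" "W \<^bold>; Z" v]
    by (simp add: clause_simps)
qed

section \<open>Soundness of the clauses\<close>

text \<open>The decoders are total and turn arbitrary numbers into formulas and structures in such a way
  that every instance of a clause, including those with numbers that code nothing, decodes to a
  sound rule.\<close>

definition op_of_tag :: "nat \<Rightarrow> form \<Rightarrow> form \<Rightarrow> form" where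
  "op_of_tag t =
    (if t = 2 then Fus else if t = 3 then Under else if t = 4 then Conj
     else if t = 5 then Disj else if t = 6 then Star else Arr)"

abbreviation code_tag :: "nat \<Rightarrow> nat" where "code_tag n \<equiv> fst (prod_decode n)"
abbreviation code_arg1 :: "nat \<Rightarrow> nat" where "code_arg1 n \<equiv> fst (prod_decode (snd (prod_decode n)))"
abbreviation code_arg2 :: "nat \<Rightarrow> nat" where "code_arg2 n \<equiv> snd (prod_decode (snd (prod_decode n)))"

text \<open>The tag is one of three summands bounded by \<open>n\<close>, so a positive tag makes
  both arguments strictly smaller. This gives termination of the decoders.\<close>

lemma code_arg_less:
  assumes "0 < code_tag n"
  shows "code_arg1 n < n" "code_arg2 n < n"
proof -
  have "prod_encode (code_tag n, prod_encode (code_arg1 n, code_arg2 n)) = n" by simp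
  then have "code_tag n + code_arg1 n + code_arg2 n \<le> n"
    by (metis prod_encode_ge_add3)
  then show "code_arg1 n < n" "code_arg2 n < n" using assms by linarith+
qed

function form_decode :: "nat \<Rightarrow> form" where
  "form_decode n =
    (if code_tag n = 0 then Var (snd (prod_decode n))
     else if code_tag n = 1 then \<^bold>\<bottom>
     else op_of_tag (code_tag n) (form_decode (code_arg1 n)) (form_decode (code_arg2 n)))"
  by auto
termination by (relation "measure id") (auto simp: code_arg_less)

function struc_decode :: "nat \<Rightarrow> struc" where
  "struc_decode n =
    (if code_tag n = 0 then F (form_decode (snd (prod_decode n)))
     else if code_tag n = 1 then struc_decode (code_arg1 n) \<^bold>, struc_decode (code_arg2 n)
     else struc_decode (code_arg1 n) \<^bold>; struc_decode (code_arg2 n))"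
  by auto
termination by (relation "measure id") (auto simp: code_arg_less)

declare form_decode.simps [simp del] struc_decode.simps [simp del]

lemma form_decode_encode [simp]:
  "form_decode (prod_encode (0, n)) = Var n"
  "form_decode (prod_encode (Suc 0, n)) = \<^bold>\<bottom>"
  "form_decode (prod_encode (2, prod_encode (x, y))) = form_decode x \<^bold>\<cdot> form_decode y"
  "form_decode (prod_encode (3, prod_encode (x, y))) = form_decode x \<^bold>\<setminus> form_decode y"
  "form_decode (prod_encode (4, prod_encode (x, y))) = form_decode x \<^bold>\<and> form_decode y"
  "form_decode (prod_encode (5, prod_encode (x, y))) = form_decode x \<^bold>\<or> form_decode y"
  "form_decode (prod_encode (6, prod_encode (x, y))) = form_decode x \<^bold>* form_decode y"
  "form_decode (prod_encode (7, prod_encode (x, y))) = form_decode x \<^bold>\<rightarrow> form_decode y"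
  by (subst form_decode.simps, simp add: op_of_tag_def)+

lemma struc_decode_encode [simp]:
  "struc_decode (prod_encode (0, n)) = F (form_decode n)"
  "struc_decode (prod_encode (Suc 0, prod_encode (x, y))) = struc_decode x \<^bold>, struc_decode y"
  "struc_decode (prod_encode (2, prod_encode (x, y))) = struc_decode x \<^bold>; struc_decode y"
  by (subst struc_decode.simps, simp)+

lemma form_decode_code [simp]: "form_decode (form_code a) = a"
  by (induction a) auto

lemma struc_decode_code [simp]: "struc_decode (struc_code X) = X"
  by (induction X) auto

text \<open>The meaning of \<open>lstep\<close> in Gb. Quantifying over all contexts builds in
  stability under the context clauses.\<close>

definition Gb_step :: "struc \<Rightarrow> struc \<Rightarrow> struc \<Rightarrow> bool" where
  "Gb_step X Y Z \<longleftrightarrow>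
    (\<forall>C c. \<turnstile>\<^sub>G\<^sub>b C\<langle>X\<rangle> \<^bold>\<Rightarrow> c \<longrightarrow> \<turnstile>\<^sub>G\<^sub>b C\<langle>Y\<rangle> \<^bold>\<Rightarrow> c \<longrightarrow> \<turnstile>\<^sub>G\<^sub>b C\<langle>Z\<rangle> \<^bold>\<Rightarrow> c)"

lemma Gb_stepD:
  assumes "Gb_step X Y Z" "\<turnstile>\<^sub>G\<^sub>b X \<^bold>\<Rightarrow> c" "\<turnstile>\<^sub>G\<^sub>b Y \<^bold>\<Rightarrow> c"
  shows "\<turnstile>\<^sub>G\<^sub>b Z \<^bold>\<Rightarrow> c"
  using assms(1)[unfolded Gb_step_def, rule_format, of Hole c] assms(2,3) by simp

lemma Gb_step_fill: "Gb_step X Y Z \<Longrightarrow> Gb_step (C\<langle>X\<rangle>) (C\<langle>Y\<rangle>) (C\<langle>Z\<rangle>)"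
  unfolding Gb_step_def by (metis fill_ctx_comp)

lemma Gb_step_contexts:
  assumes "Gb_step X Y Z"
  shows "Gb_step (X \<^bold>, W) (Y \<^bold>, W) (Z \<^bold>, W)" "Gb_step (W \<^bold>, X) (W \<^bold>, Y) (W \<^bold>, Z)"
    "Gb_step (X \<^bold>; W) (Y \<^bold>; W) (Z \<^bold>; W)" "Gb_step (W \<^bold>; X) (W \<^bold>; Y) (W \<^bold>; Z)"
  using Gb_step_fill[OF assms, of "CommaL Hole W"] Gb_step_fill[OF assms, of "CommaR W Hole"]
    Gb_step_fill[OF assms, of "SemiL Hole W"] Gb_step_fill[OF assms, of "SemiR W Hole"]
  by simp_all

lemma Gb_step_rules:
  "Gb_step (F a \<^bold>, F b) (F a \<^bold>, F b) (F (a \<^bold>\<cdot> b))"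
  "Gb_step (F a \<^bold>; F b) (F a \<^bold>; F b) (F (a \<^bold>* b))"
  "\<turnstile>\<^sub>G\<^sub>b X \<^bold>\<Rightarrow> a \<Longrightarrow> Gb_step (F b) (F b) (X \<^bold>, F (a \<^bold>\<setminus> b))"
  "\<turnstile>\<^sub>G\<^sub>b X \<^bold>\<Rightarrow> a \<Longrightarrow> Gb_step (F b) (F b) (X \<^bold>; F (a \<^bold>\<rightarrow> b))"
  "Gb_step (F a) (F a) (F (a \<^bold>\<and> b))"
  "Gb_step (F b) (F b) (F (a \<^bold>\<and> b))"
  "Gb_step (F a) (F b) (F (a \<^bold>\<or> b))"
  "Gb_step (X \<^bold>, Y) (X \<^bold>, Y) (Y \<^bold>, X)"
  "Gb_step (X \<^bold>; Y) (X \<^bold>; Y) (Y \<^bold>; X)"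
  "Gb_step (X \<^bold>, (Y \<^bold>, Z)) (X \<^bold>, (Y \<^bold>, Z)) ((X \<^bold>, Y) \<^bold>, Z)"
  "Gb_step ((X \<^bold>, Y) \<^bold>, Z) ((X \<^bold>, Y) \<^bold>, Z) (X \<^bold>, (Y \<^bold>, Z))"
  unfolding Gb_step_def
  by (intro allI impI;
      (rule FusL StarL UnderL ArrL ConjL1 ConjL2 DisjL Ex ExSemi As1 As2; assumption))+

lemma Gb_Bot_contexts:
  assumes "\<turnstile>\<^sub>G\<^sub>b X \<^bold>\<Rightarrow> \<^bold>\<bottom>"
  shows "\<turnstile>\<^sub>G\<^sub>b X \<^bold>\<Rightarrow> a" "\<turnstile>\<^sub>G\<^sub>b X \<^bold>, W \<^bold>\<Rightarrow> \<^bold>\<bottom>" "\<turnstile>\<^sub>G\<^sub>b W \<^bold>, X \<^bold>\<Rightarrow> \<^bold>\<bottom>" "\<turnstile>\<^sub>G\<^sub>b X \<^bold>; W \<^bold>\<Rightarrow> \<^bold>\<bottom>"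
    "\<turnstile>\<^sub>G\<^sub>b W \<^bold>; X \<^bold>\<Rightarrow> \<^bold>\<bottom>"
  using BotRule[OF assms, of Hole] BotRule[OF assms, of "CommaL Hole W"]
    BotRule[OF assms, of "CommaR W Hole"] BotRule[OF assms, of "SemiL Hole W"]
    BotRule[OF assms, of "SemiR W Hole"]
  by simp_all

text \<open>The invariant for \<open>horn_derivable_induct\<close>, defined on every number: tag 0
  is read as a sequent and any other tag as a step.\<close>

definition true_code :: "nat \<Rightarrow> bool" where
  "true_code n \<longleftrightarrow>
    (case prod_decode n of (t, m) \<Rightarrow> case prod_decode m of (x, u) \<Rightarrow>
      if t = 0 then \<turnstile>\<^sub>G\<^sub>b struc_decode x \<^bold>\<Rightarrow> form_decode u
      else case prod_decode u of (y, z) \<Rightarrow>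
        Gb_step (struc_decode x) (struc_decode y) (struc_decode z))"

lemma true_code_encode [simp]:
  "true_code (prod_encode (0, prod_encode (x, u))) \<longleftrightarrow> \<turnstile>\<^sub>G\<^sub>b struc_decode x \<^bold>\<Rightarrow> form_decode u"
  "true_code (prod_encode (Suc 0, prod_encode (x, prod_encode (y, z)))) \<longleftrightarrow>
    Gb_step (struc_decode x) (struc_decode y) (struc_decode z)"
  by (simp_all add: true_code_def)

text \<open>The decoders commute with the coded constructors at arbitrary arguments, so each clause
  instance decodes to a rule or a derived rule of Gb.\<close>

lemma closed_true_code: "closed 4 clauses B (\<lambda>i. i \<le> B \<and> true_code i)"
  unfolding closed_def
proof (intro allI impI)
  fix ys :: "nat list" assume "length ys = 4"
  then obtain x y z w where ys: "ys = [x, y, z, w]"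
    by (auto simp: numeral_eq_Suc length_Suc_conv)
  show "\<forall>q\<in>set clauses. holds B (\<lambda>i. i \<le> B \<and> true_code i) ys q"
    unfolding ys clauses_def Let_def holds_def
    by (simp add: Gb_step_rules Gb_step_contexts Id FusR StarR UnderR ArrR ConjR DisjR1 DisjR2)
      (intro conjI impI; blast intro: Gb_stepD RBot Gb_Bot_contexts)
qed

text \<open>The code \<open>k\<close> bounds the variable indices, and the weight is at most
  \<open>(3 * k + 2) + (3 * k + 1)\<close>; two further rounds account for the coding of judgements.
  The multiple of \<open>k\<close> is written as a sum so that \<open>recursive_add\<close> handles
  it.\<close>

lemma Gb_iff_horn_derivable:
  fixes X a
  defines "k \<equiv> sequent_code (X \<^bold>\<Rightarrow> a)"
  shows "\<turnstile>\<^sub>G\<^sub>b X \<^bold>\<Rightarrow> a \<longleftrightarrow>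
    horn_derivable 4 clauses (code_bound k (k + k + k + k + k + k + 5)) (prod_encode (0, k))"
    (is "_ \<longleftrightarrow> horn_derivable 4 clauses ?B _")
proof
  assume "\<turnstile>\<^sub>G\<^sub>b X \<^bold>\<Rightarrow> a"
  then have cf: "cf X a" by (rule cut_elimination)
  have k: "struc_code X \<le> k" "form_code a \<le> k"
    by (simp_all add: k_def le_prod_encode_1 le_prod_encode_2)
  have B: "?B = code_bound k ((6 * k + 3) + 2)" by (simp add: algebra_simps)
  have weight: "sweight X + fweight a \<le> 6 * k + 3"
    using k sweight_le_code[of X] fweight_le_code[of a] by linarith
  show "horn_derivable 4 clauses ?B (prod_encode (0, k))"
    unfolding horn_derivable_def
  proof (intro allI impI)
    fix T assume "closed 4 clauses ?B (\<lambda>i. i \<in> set_decode T)"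
    then have "closed 4 clauses (code_bound k ((6 * k + 3) + 2)) (\<lambda>i. i \<in> set_decode T)"
      unfolding B .
    from cf_in_closed(1)[OF this cf weight svars_le_mono[OF svars_le_code k(1)]
        fvars_le_mono[OF fvars_le_code k(2)]]
    show "prod_encode (0, k) \<in> set_decode T" by (simp add: k_def)
  qed
next
  assume "horn_derivable 4 clauses ?B (prod_encode (0, k))"
  \<comment> \<open>Decoding the two components of \<open>k\<close> gives back \<open>X\<close> and
    \<open>a\<close>.\<close>
  from horn_derivable_induct[OF this closed_true_code] show "\<turnstile>\<^sub>G\<^sub>b X \<^bold>\<Rightarrow> a"
    by (simp add: k_def)
qed

theorem theorem6: "decidable_wrt sequent_code (\<lambda>s. \<turnstile>\<^sub>G\<^sub>b s)"
proof -
  define f :: "nat list \<Rightarrow> nat" where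
    "f xs = (let k = xs ! 0 in code_bound k (k + k + k + k + k + k + 5))" for xs
  define g :: "nat list \<Rightarrow> nat" where "g xs = prod_encode (0, xs ! 0)" for xs
  have "recursive 1 f" "recursive 1 g"
    unfolding f_def g_def Let_def
    by (intro recursive_code_bound recursive_add recursive_proj recursive_const
        recursive_prod_encode; simp)+
  \<comment> \<open>Both \<open>f\<close> and \<open>g\<close> read only the code of the sequent, so
    a single program \<open>r\<close> serves all sequents.\<close>
  from recursive_horn_derivable[OF clauses_vars this]
  obtain r where r: "\<And>xs. length xs = 1 \<Longrightarrow>
      computes r xs (of_bool (horn_derivable 4 clauses (f xs) (g xs)))"
    unfolding recursive_predicate_def recursive_def by blast
  have "computes r [sequent_code s] (if \<turnstile>\<^sub>G\<^sub>b s then 1 else 0)" for s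
  proof (cases s)
    case (Sequent X a)
    show ?thesis
      using r[of "[sequent_code s]"]
      by (simp add: Sequent Gb_iff_horn_derivable f_def g_def of_bool_def Let_def
          del: sequent_code.simps)
  qed
  then show ?thesis unfolding decidable_wrt_def by blast
qed

end
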